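(* The incremental topological ordering method via compatible search with a soft threshold, as described in the context, processes any sequence of arc additions in amortized time $O(m^{1/2})$ per arc addition, where $m$ is the total number of arcs added: worst-case (i.e., the total time is $O(m^{3/2})$ deterministically) if each soft threshold chosen in Cases 1f and 1b is an $\epsilon$-approximate median (for a fixed constant $\epsilon>0$) of the set from which it is chosen, and in expectation if each such soft threshold is chosen uniformly at random from that set.
   Context: Setting: a fixed vertex set; initially no arcs; arcs are added one at a time, $m$ being the total number added (processing stops when a cycle is reported). A topological order is a total order $<$ of the vertices with $x<y$ for every arc $(x,y)$. The method maintains a total order of the vertices (initially arbitrary) in a dynamic ordered-list structure with $O(1)$ (amortized) time order queries, deletions, and insertions just before/after a given vertex, together with the outgoing and incoming arc lists of each vertex. To add $(v,w)$: add it to the arc lists; if $v<w$ stop. Otherwise search as follows. A vertex is forward if it is $w$ or was reached from $w$ by traversing arcs forward, backward if it is $v$ or was reached from $v$ by traversing arcs backward, unreached otherwise. Maintain thresholds $l,h,s$, sets $A,B$ (candidate forward vertices), $C,D$ (candidate backward vertices), and $X,Y$. Initialize $l=w$, $h=v$, $s$ to $v$, $w$ or any vertex between them, $A=\{w\}$, $C=\{v\}$, others empty. Repeat an applicable case until $A\cup B$ or $C\cup D$ is empty: Case 1f: $A=\emptyset$: move all of $B$ into $A$, set $l=s$, let $s$ be a vertex of $A$, then set $s=\min\{s,h\}$. Case 1b: $C=\emptyset$: move all of $D$ into $C$, set $h=s$, let $s$ be a vertex of $C$, then set $s=\max\{s,l\}$. Otherwise choose $u\in A$, $z\in C$. Case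 2f: $u\ge h$: delete $u$ from $A$. Case 2b: $z\le l$: delete $z$ from $C$. Case 3f: $\max\{z,s\}\le u<h$: move $u$ from $A$ to $B$. Case 3b: $l<z\le\min\{u,s\}$: move $z$ from $C$ to $D$. Case 4f: all arcs out of $u$ traversed: move $u$ from $A$ to $X$. Case 4b: all arcs into $z$ traversed: move $z$ from $C$ to $Y$. Case 5: otherwise traverse an untraversed arc $(u,x)$ out of $u$ and an untraversed arc $(y,z)$ into $z$; if $x$ is backward or $y$ is forward stop and report a cycle; if $x$ is unreached make it forward and add it to $A$; if $y$ is unreached make it backward and add it to $C$. If no cycle is reported, set $s=h$ if $A\cup B$ is empty and $s=l$ otherwise; remove from $X$ all vertices $\ge s$ and from $Y$ all vertices $\le s$; compute topological orders $O_X,O_Y$ of the subgraphs induced by $X$ and $Y$ with a linear-time static algorithm; if $s$ is not forward, delete $X\cup Y$ from the order and reinsert just after $s$ in order $O_Y$ then $O_X$, otherwise just before $s$ in order $O_Y$ then $O_X$. An $\epsilon$-approximate median of a totally ordered set of $g$ elements is an element greater than or equal to at least $\epsilon g$ of the elements and less than or equal to at least $\epsilon g$ of them; it can be computed in $O(g)$ time.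
   Formalization: For the chosen u and z, a case is applied only if no lower-numbered case applies (f/b ties free), since with an arbitrary applicable case the search can alternate Cases 3b and 1b forever; arcs (v,v) are excluded. *)

theory Defs
  imports "HOL-Probability.Probability"
begin

section \<open>The maintained order\<close>

text \<open>The dynamic ordered list is a duplicate-free list of the vertices.\<close>

definition prec :: "'v list \<Rightarrow> 'v \<Rightarrow> 'v \<Rightarrow> bool" where
  "prec L x y \<longleftrightarrow> (\<exists>i j. i < j \<and> j < length L \<and> L ! i = x \<and> L ! j = y)"

definition preceq :: "'v list \<Rightarrow> 'v \<Rightarrow> 'v \<Rightarrow> bool" where
  "preceq L x y \<longleftrightarrow> x = y \<or> prec L x y"

definition omin :: "'v list \<Rightarrow> 'v \<Rightarrow> 'v \<Rightarrow> 'v" where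
  "omin L x y = (if prec L x y then x else y)"

definition omax :: "'v list \<Rightarrow> 'v \<Rightarrow> 'v \<Rightarrow> 'v" where
  "omax L x y = (if prec L x y then y else x)"

definition topological_order_on :: "('v \<times> 'v) list \<Rightarrow> 'v set \<Rightarrow> 'v list \<Rightarrow> bool" where
  "topological_order_on es Z L \<longleftrightarrow> distinct L \<and> set L = Z \<and>
     (\<forall>(x, y) \<in> set es. x \<in> Z \<and> y \<in> Z \<longrightarrow> prec L x y)"

definition approx_median :: "real \<Rightarrow> 'v list \<Rightarrow> 'v set \<Rightarrow> 'v \<Rightarrow> bool" where
  "approx_median eps L S t \<longleftrightarrow> t \<in> S \<and>
     eps * real (card S) \<le> real (card {x \<in> S. preceq L x t}) \<and>
     eps * real (card S) \<le> real (card {x \<in> S. preceq L t x})"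


section \<open>Search states\<close>

text \<open>
  The arcs are given as a list in order of addition and are identified by their index in it
  (so parallel arcs are allowed); while arc number \<open>k\<close> is being added, the arcs present are
  those with index at most \<open>k\<close>.
\<close>

record 'v search =
  lo :: 'v
  hi :: 'v
  soft :: 'v
  setA :: "'v set"
  setB :: "'v set"
  setC :: "'v set"
  setD :: "'v set"
  setX :: "'v set"
  setY :: "'v set"
  fwd :: "'v set"
  bwd :: "'v set"
  trav :: "nat set"

definition init_search :: "'v \<Rightarrow> 'v \<Rightarrow> 'v \<Rightarrow> 'v search" where
  "init_search v w s =
     \<lparr>lo = w, hi = v, soft = s, setA = {w}, setB = {}, setC = {v}, setD = {},
      setX = {}, setY = {}, fwd = {w}, bwd = {v}, trav = {}\<rparr>"

definition running :: "'v search \<Rightarrow> bool" where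
  "running q \<longleftrightarrow> setA q \<union> setB q \<noteq> {} \<and> setC q \<union> setD q \<noteq> {}"

definition unreached :: "'v search \<Rightarrow> 'v \<Rightarrow> bool" where
  "unreached q x \<longleftrightarrow> x \<notin> fwd q \<and> x \<notin> bwd q"

definition out_arcs :: "('v \<times> 'v) list \<Rightarrow> nat \<Rightarrow> 'v \<Rightarrow> nat set" where
  "out_arcs es k u = {i. i \<le> k \<and> i < length es \<and> fst (es ! i) = u}"

definition in_arcs :: "('v \<times> 'v) list \<Rightarrow> nat \<Rightarrow> 'v \<Rightarrow> nat set" where
  "in_arcs es k z = {i. i \<le> k \<and> i < length es \<and> snd (es ! i) = z}"

definition cond2f :: "'v list \<Rightarrow> 'v search \<Rightarrow> 'v \<Rightarrow> bool" where
  "cond2f L q u \<longleftrightarrow> preceq L (hi q) u"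

definition cond2b :: "'v list \<Rightarrow> 'v search \<Rightarrow> 'v \<Rightarrow> bool" where
  "cond2b L q z \<longleftrightarrow> preceq L z (lo q)"

definition cond3f :: "'v list \<Rightarrow> 'v search \<Rightarrow> 'v \<Rightarrow> 'v \<Rightarrow> bool" where
  "cond3f L q u z \<longleftrightarrow> preceq L (omax L z (soft q)) u \<and> prec L u (hi q)"

definition cond3b :: "'v list \<Rightarrow> 'v search \<Rightarrow> 'v \<Rightarrow> 'v \<Rightarrow> bool" where
  "cond3b L q u z \<longleftrightarrow> prec L (lo q) z \<and> preceq L z (omin L u (soft q))"

definition cond4f :: "('v \<times> 'v) list \<Rightarrow> nat \<Rightarrow> 'v search \<Rightarrow> 'v \<Rightarrow> bool" where
  "cond4f es k q u \<longleftrightarrow> out_arcs es k u \<subseteq> trav q"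

definition cond4b :: "('v \<times> 'v) list \<Rightarrow> nat \<Rightarrow> 'v search \<Rightarrow> 'v \<Rightarrow> bool" where
  "cond4b es k q z \<longleftrightarrow> in_arcs es k z \<subseteq> trav q"

text \<open>
  Once both arcs of a traversal step have been traversed, their far ends \<open>x\<close> and \<open>y\<close> have been
  reached forward and backward respectively; hence \<open>x = y\<close> also makes \<open>x\<close> backward and \<open>y\<close>
  forward, and is a cycle.
\<close>

definition closes_cycle :: "'v search \<Rightarrow> 'v \<Rightarrow> 'v \<Rightarrow> bool" where
  "closes_cycle q x y \<longleftrightarrow> x \<in> insert y (bwd q) \<or> y \<in> insert x (fwd q)"

definition traverse :: "'v search \<Rightarrow> nat \<Rightarrow> 'v \<Rightarrow> nat \<Rightarrow> 'v \<Rightarrow> 'v search" where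
  "traverse q i x j y =
     q\<lparr>trav := trav q \<union> {i, j},
       fwd := insert x (fwd q),
       setA := (if unreached q x then insert x (setA q) else setA q),
       bwd := insert y (bwd q),
       setC := (if unreached q y then insert y (setC q) else setC q)\<rparr>"

definition end_pos :: "'v search \<Rightarrow> 'v" where
  "end_pos q = (if setA q \<union> setB q = {} then hi q else lo q)"

definition reordered :: "('v \<times> 'v) list \<Rightarrow> nat \<Rightarrow> 'v list \<Rightarrow> 'v search \<Rightarrow> 'v list \<Rightarrow> bool" where
  "reordered es k L q L' \<longleftrightarrow>
     (let s = end_pos q;
          X = {x \<in> setX q. \<not> preceq L s x};
          Y = {y \<in> setY q. \<not> preceq L y s}
      in \<exists>OX OY P Q.
           topological_order_on (take (Suc k) es) X OX \<and>
           topological_order_on (take (Suc k) es) Y OY \<and>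
           filter (\<lambda>x. x \<notin> X \<union> Y) L = P @ s # Q \<and>
           L' = (if s \<notin> fwd q then P @ s # OY @ OX @ Q else P @ OY @ OX @ s # Q))"


section \<open>The method as a nondeterministic transition system\<close>

text \<open>
  \<open>Ready k L\<close>: \<open>k\<close> arcs have been processed and the order is \<open>L\<close>.  \<open>Search k L q\<close>: the search for
  arc \<open>k\<close> is between two case applications.  \<open>PickF\<close> and \<open>PickB\<close>: between \<open>case1f\<close> (\<open>case1b\<close>) and
  the choice of the new soft threshold from \<open>A\<close> (from \<open>C\<close>).  \<open>Cycle\<close>: a cycle was reported.
\<close>

datatype 'v conf =
    Ready nat "'v list"
  | Search nat "'v list" "'v search"
  | PickF nat "'v list" "'v search"
  | PickB nat "'v list" "'v search"
  | Cycle

definition set_softF :: "nat \<Rightarrow> 'v list \<Rightarrow> 'v search \<Rightarrow> 'v \<Rightarrow> 'v conf" where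
  "set_softF k L q t = Search k L (q\<lparr>soft := omin L t (hi q)\<rparr>)"

definition set_softB :: "nat \<Rightarrow> 'v list \<Rightarrow> 'v search \<Rightarrow> 'v \<Rightarrow> 'v conf" where
  "set_softB k L q t = Search k L (q\<lparr>soft := omax L t (lo q)\<rparr>)"

text \<open>
  The predicate \<open>R\<close> restricts the soft thresholds: \<open>R L S t\<close> says that \<open>t\<close> may be chosen from
  the set \<open>S\<close> ordered by \<open>L\<close>.  All other choices (initial \<open>s\<close>, the vertices \<open>u\<close> and \<open>z\<close>, the
  arcs, the orders of \<open>X\<close> and \<open>Y\<close>) are arbitrary.

  A case is applied only if no lower-numbered case is applicable to the chosen \<open>u\<close> and \<open>z\<close>;
  between the f and the b version of a case the choice is free.  Some priority is needed: if
  \<open>C = {z}\<close>, \<open>D = {}\<close>, \<open>lo < z = soft = hi \<le> u\<close>, then applying \<open>case3b\<close> rather than \<open>case2f\<close> leads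
  via \<open>case1b\<close> back to the same state.
\<close>

inductive step ::
  "('v list \<Rightarrow> 'v set \<Rightarrow> 'v \<Rightarrow> bool) \<Rightarrow> ('v \<times> 'v) list \<Rightarrow> 'v conf \<Rightarrow> 'v conf \<Rightarrow> bool"
  for R :: "'v list \<Rightarrow> 'v set \<Rightarrow> 'v \<Rightarrow> bool" and es :: "('v \<times> 'v) list" where
  add_consistent:
    "\<lbrakk>k < length es; es ! k = (v, w); prec L v w\<rbrakk>
     \<Longrightarrow> step R es (Ready k L) (Ready (Suc k) L)"
| add_search:
    "\<lbrakk>k < length es; es ! k = (v, w); \<not> prec L v w; preceq L w s; preceq L s v\<rbrakk>
     \<Longrightarrow> step R es (Ready k L) (Search k L (init_search v w s))"
| case1f:
    "\<lbrakk>running q; setA q = {}\<rbrakk>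
     \<Longrightarrow> step R es (Search k L q)
           (PickF k L (q\<lparr>setA := setB q, setB := {}, lo := soft q\<rparr>))"
| pickf:
    "\<lbrakk>t \<in> setA q; R L (setA q) t\<rbrakk>
     \<Longrightarrow> step R es (PickF k L q) (set_softF k L q t)"
| case1b:
    "\<lbrakk>running q; setC q = {}\<rbrakk>
     \<Longrightarrow> step R es (Search k L q)
           (PickB k L (q\<lparr>setC := setD q, setD := {}, hi := soft q\<rparr>))"
| pickb:
    "\<lbrakk>t \<in> setC q; R L (setC q) t\<rbrakk>
     \<Longrightarrow> step R es (PickB k L q) (set_softB k L q t)"
| case2f:
    "\<lbrakk>u \<in> setA q; z \<in> setC q; cond2f L q u\<rbrakk>
     \<Longrightarrow> step R es (Search k L q) (Search k L (q\<lparr>setA := setA q - {u}\<rparr>))"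
| case2b:
    "\<lbrakk>u \<in> setA q; z \<in> setC q; cond2b L q z\<rbrakk>
     \<Longrightarrow> step R es (Search k L q) (Search k L (q\<lparr>setC := setC q - {z}\<rparr>))"
| case3f:
    "\<lbrakk>u \<in> setA q; z \<in> setC q; \<not> cond2f L q u; \<not> cond2b L q z; cond3f L q u z\<rbrakk>
     \<Longrightarrow> step R es (Search k L q)
           (Search k L (q\<lparr>setA := setA q - {u}, setB := insert u (setB q)\<rparr>))"
| case3b:
    "\<lbrakk>u \<in> setA q; z \<in> setC q; \<not> cond2f L q u; \<not> cond2b L q z; cond3b L q u z\<rbrakk>
     \<Longrightarrow> step R es (Search k L q)
           (Search k L (q\<lparr>setC := setC q - {z}, setD := insert z (setD q)\<rparr>))"
| case4f:
    "\<lbrakk>u \<in> setA q; z \<in> setC q; \<not> cond2f L q u; \<not> cond2b L q z;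
      \<not> cond3f L q u z; \<not> cond3b L q u z; cond4f es k q u\<rbrakk>
     \<Longrightarrow> step R es (Search k L q)
           (Search k L (q\<lparr>setA := setA q - {u}, setX := insert u (setX q)\<rparr>))"
| case4b:
    "\<lbrakk>u \<in> setA q; z \<in> setC q; \<not> cond2f L q u; \<not> cond2b L q z;
      \<not> cond3f L q u z; \<not> cond3b L q u z; cond4b es k q z\<rbrakk>
     \<Longrightarrow> step R es (Search k L q)
           (Search k L (q\<lparr>setC := setC q - {z}, setY := insert z (setY q)\<rparr>))"
| case5:
    "\<lbrakk>u \<in> setA q; z \<in> setC q; \<not> cond2f L q u; \<not> cond2b L q z;
      \<not> cond3f L q u z; \<not> cond3b L q u z; \<not> cond4f es k q u; \<not> cond4b es k q z;
      i \<in> out_arcs es k u - trav q; j \<in> in_arcs es k z - trav q;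
      x = snd (es ! i); y = fst (es ! j)\<rbrakk>
     \<Longrightarrow> step R es (Search k L q)
           (if closes_cycle q x y then Cycle else Search k L (traverse q i x j y))"
| restore:
    "\<lbrakk>\<not> running q; reordered es k L q L'\<rbrakk>
     \<Longrightarrow> step R es (Search k L q) (Ready (Suc k) L')"

abbreviation any_threshold :: "'v list \<Rightarrow> 'v set \<Rightarrow> 'v \<Rightarrow> bool" where
  "any_threshold \<equiv> \<lambda>L S t. True"

fun finished :: "('v \<times> 'v) list \<Rightarrow> 'v conf \<Rightarrow> bool" where
  "finished es (Ready k L) \<longleftrightarrow> k \<ge> length es"
| "finished es Cycle \<longleftrightarrow> True"
| "finished es c \<longleftrightarrow> False"


section \<open>Running time\<close>

text \<open>
  \<open>cost es c\<close> is the time, up to a constant factor, of the transition out of \<open>c\<close>.  Adding an arc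
  to the arc lists and each case application take a bounded number of order queries, set moves and
  arc traversals.  Choosing a soft threshold is charged the size of the set it is chosen from,
  which pays for computing a median and for moving the set.  Restoring the order is charged the
  vertices of \<open>X\<close> and \<open>Y\<close> and the arcs out of \<open>X\<close> and into \<open>Y\<close>, which are scanned to find the
  induced subgraphs; this pays for the linear-time topological sorts and for the deletions and
  insertions in the ordered list.  Charging one unit for an ordered-list operation that takes
  constant amortized time is sound because only sums over whole executions are considered.
\<close>

fun cost :: "('v \<times> 'v) list \<Rightarrow> 'v conf \<Rightarrow> nat" where
  "cost es (Ready k L) = (if k < length es then 1 else 0)"
| "cost es (Search k L q) =
     (if running q then 1
      else 1 + card (setX q) + card (setY q)
             + card (\<Union>x \<in> setX q. out_arcs es k x) + card (\<Union>y \<in> setY q. in_arcs es k y))"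
| "cost es (PickF k L q) = 1 + card (setA q)"
| "cost es (PickB k L q) = 1 + card (setC q)"
| "cost es Cycle = 0"

text \<open>\<open>exec R es c t c'\<close>: some finite execution leads from \<open>c\<close> to \<open>c'\<close> in total time \<open>t\<close>.\<close>

inductive exec ::
  "('v list \<Rightarrow> 'v set \<Rightarrow> 'v \<Rightarrow> bool) \<Rightarrow> ('v \<times> 'v) list \<Rightarrow> 'v conf \<Rightarrow> nat \<Rightarrow> 'v conf \<Rightarrow> bool"
  for R :: "'v list \<Rightarrow> 'v set \<Rightarrow> 'v \<Rightarrow> bool" and es :: "('v \<times> 'v) list" and c :: "'v conf" where
  exec_refl: "exec R es c 0 c"
| exec_step: "\<lbrakk>exec R es c t c'; step R es c' c''\<rbrakk> \<Longrightarrow> exec R es c (t + cost es c') c''"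


section \<open>Random soft thresholds\<close>

text \<open>
  The choices other than the soft thresholds are resolved by a policy, which may depend on the
  whole history (a nonempty list of configurations, latest first), hence on all earlier random
  choices, but not on later ones.
\<close>

definition policy :: "('v \<times> 'v) list \<Rightarrow> ('v conf list \<Rightarrow> 'v conf) \<Rightarrow> bool" where
  "policy es \<sigma> \<longleftrightarrow>
     (\<forall>c h. (\<exists>c'. step any_threshold es c c') \<longrightarrow> step any_threshold es c (\<sigma> (c # h)))"

definition random_step ::
  "('v \<times> 'v) list \<Rightarrow> ('v conf list \<Rightarrow> 'v conf) \<Rightarrow> 'v conf list \<Rightarrow> 'v conf pmf" where
  "random_step es \<sigma> h =
     (case hd h of
        PickF k L q \<Rightarrow> map_pmf (set_softF k L q) (pmf_of_set (setA q))
      | PickB k L q \<Rightarrow> map_pmf (set_softB k L q) (pmf_of_set (setC q))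
      | c \<Rightarrow> return_pmf (if finished es c then c else \<sigma> h))"

primrec history ::
  "('v \<times> 'v) list \<Rightarrow> ('v conf list \<Rightarrow> 'v conf) \<Rightarrow> 'v conf \<Rightarrow> nat \<Rightarrow> 'v conf list pmf" where
  "history es \<sigma> c 0 = return_pmf [c]"
| "history es \<sigma> c (Suc n) =
     bind_pmf (history es \<sigma> c n) (\<lambda>h. map_pmf (\<lambda>c'. c' # h) (random_step es \<sigma> h))"

definition elapsed :: "('v \<times> 'v) list \<Rightarrow> 'v conf list \<Rightarrow> nat" where
  "elapsed es h = sum_list (map (cost es) (tl h))"

text \<open>
  Elapsed time is nondecreasing in the number \<open>n\<close> of transitions (finished configurations repeat
  at cost 0), so by monotone convergence the supremum is the expectation of the total time.
\<close>

definition expected_time ::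
  "('v \<times> 'v) list \<Rightarrow> ('v conf list \<Rightarrow> 'v conf) \<Rightarrow> 'v conf \<Rightarrow> ennreal" where
  "expected_time es \<sigma> c =
     (SUP n. \<integral>\<^sup>+ h. of_nat (elapsed es h) \<partial>measure_pmf (history es \<sigma> c n))"


section \<open>Problem instances\<close>

text \<open>\<open>L\<close> is the arbitrary initial order of the vertex set.  Loops are excluded: no order is
  topological for a graph with a loop.\<close>

definition arc_sequence :: "'v list \<Rightarrow> ('v \<times> 'v) list \<Rightarrow> bool" where
  "arc_sequence L es \<longleftrightarrow> distinct L \<and>
     (\<forall>(v, w) \<in> set es. v \<in> set L \<and> w \<in> set L \<and> v \<noteq> w)"

end

theory Submission
  imports Defs
begin

text \<open>
  In Case 5 the forward vertex \<open>u\<close> precedes the backward vertex \<open>z\<close>, so the arc out of \<open>u\<close> and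
  the arc into \<open>z\<close> become related (lie on a common path) only through the new arc.  Hence \<open>n\<close>
  executions of Case 5 in one search create \<open>\<Omega>(n\<^sup>2)\<close> of the at most \<open>m\<^sup>2\<close> related arc pairs, and by
  \<open>n \<le> \<surd>m + n\<^sup>2 / \<surd>m\<close> there are \<open>O(m \<surd>m)\<close> executions in total.

  Within a search, the next Case 1f or 1b makes one side of the soft threshold inactive, and an
  inactive vertex is moved at most once more between the candidate sets.  The loss of active vertices
  on the smaller side pays for the selection of a central threshold; for a uniformly random
  threshold it does so in expectation, and the elapsed time plus the potential is a supermartingale.
\<close>

section \<open>Ranks in the maintained order\<close>

text \<open>The bound must hold for executions cut off anywhere and, in the random case, against a
  policy that sees the past, so all accounts are merged into one potential \<open>pot\<close> that
  is checked transition by transition. Two obstacles shape it. When a threshold is chosen, it is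
  still open whether Case 1f or Case 1b comes next; so the local potential keeps the larger side
  (\<open>spread\<close>), and only the smaller side, measured by \<open>mid_rank\<close>, can be
  promised as a gain. And the related pairs that pay for traversals enter \<open>base\<close> only
  when the search ends; so the traversals are deducted in advance, and \<open>trav_related\<close>,
  valid at every moment of a search, keeps \<open>pot\<close> nonnegative. Both threshold rules
  enter through one inequality: a choice of \<open>t\<close> from \<open>S\<close> overdraws the
  potential by at most \<open>4 * card S - c * mid_rank L S t\<close>. An approximate median makes
  this nonpositive for \<open>c = 4 / eps\<close>; under a uniform choice the mean of
  \<open>mid_rank\<close> is at least \<open>card S / 6\<close>, whence
  \<open>c = 24\<close>.\<close>

definition rk :: "'v list \<Rightarrow> 'v \<Rightarrow> nat" where
  "rk L x = (THE i. i < length L \<and> L ! i = x)"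

lemma rk_nth: "distinct L \<Longrightarrow> i < length L \<Longrightarrow> rk L (L ! i) = i"
  unfolding rk_def by (rule the_equality) (auto simp: nth_eq_iff_index_eq)

lemma nth_rk: "distinct L \<Longrightarrow> x \<in> set L \<Longrightarrow> rk L x < length L \<and> L ! rk L x = x"
  by (metis in_set_conv_nth rk_nth)

lemma rk_eq: "distinct L \<Longrightarrow> x \<in> set L \<Longrightarrow> y \<in> set L \<Longrightarrow> rk L x = rk L y \<longleftrightarrow> x = y"
  by (metis nth_rk)

lemma prec_set: "prec L x y \<Longrightarrow> x \<in> set L \<and> y \<in> set L"
  unfolding prec_def by (metis less_trans nth_mem)

lemma prec_rk: "distinct L \<Longrightarrow> x \<in> set L \<Longrightarrow> y \<in> set L \<Longrightarrow> prec L x y \<longleftrightarrow> rk L x < rk L y"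
  unfolding prec_def by (metis less_trans nth_rk rk_nth)

lemma preceq_rk: "distinct L \<Longrightarrow> x \<in> set L \<Longrightarrow> y \<in> set L \<Longrightarrow> preceq L x y \<longleftrightarrow> rk L x \<le> rk L y"
  unfolding preceq_def by (metis le_less prec_rk rk_eq)

lemma omin_in: "x \<in> S \<Longrightarrow> y \<in> S \<Longrightarrow> omin L x y \<in> S"
  and omax_in: "x \<in> S \<Longrightarrow> y \<in> S \<Longrightarrow> omax L x y \<in> S"
  by (auto simp: omin_def omax_def)

lemma rk_omin:
  "distinct L \<Longrightarrow> x \<in> set L \<Longrightarrow> y \<in> set L \<Longrightarrow> rk L (omin L x y) = min (rk L x) (rk L y)"
  by (auto simp: omin_def prec_rk)

lemma rk_omax:
  "distinct L \<Longrightarrow> x \<in> set L \<Longrightarrow> y \<in> set L \<Longrightarrow> rk L (omax L x y) = max (rk L x) (rk L y)"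
  by (auto simp: omax_def prec_rk)

lemmas rk_simps = prec_rk preceq_rk rk_omin rk_omax omin_in omax_in

lemma prec_Cons: "prec (a # L) x y \<longleftrightarrow> (x = a \<and> y \<in> set L) \<or> prec L x y"
proof
  assume "prec (a # L) x y"
  then obtain i j where "i < j" "j < Suc (length L)" "(a # L) ! i = x" "(a # L) ! j = y"
    by (auto simp: prec_def)
  then show "(x = a \<and> y \<in> set L) \<or> prec L x y"
    by (cases i; cases j) (auto simp: prec_def)
next
  assume "(x = a \<and> y \<in> set L) \<or> prec L x y"
  then show "prec (a # L) x y"
  proof
    assume "x = a \<and> y \<in> set L"
    then obtain j where "j < length L" "L ! j = y" "x = a" by (auto simp: in_set_conv_nth)
    then show ?thesis unfolding prec_def by (intro exI[of _ 0] exI[of _ "Suc j"]) auto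
  next
    assume "prec L x y"
    then obtain i j where "i < j" "j < length L" "L ! i = x" "L ! j = y" by (auto simp: prec_def)
    then show ?thesis unfolding prec_def by (intro exI[of _ "Suc i"] exI[of _ "Suc j"]) auto
  qed
qed

lemma prec_Nil: "\<not> prec [] x y"
  by (simp add: prec_def)

lemma prec_append:
  "prec (L @ M) x y \<longleftrightarrow> prec L x y \<or> prec M x y \<or> (x \<in> set L \<and> y \<in> set M)"
  by (induction L) (auto simp: prec_Cons prec_Nil)

lemma prec_filter: "prec (filter P L) x y \<longleftrightarrow> P x \<and> P y \<and> prec L x y"
proof (induction L)
  case (Cons a L)
  then show ?case using prec_set[of L x y] by (auto simp: prec_Cons)
qed (simp add: prec_Nil)

section \<open>Invariants\<close>

definition order_inv :: "('v \<times> 'v) list \<Rightarrow> 'v set \<Rightarrow> nat \<Rightarrow> 'v list \<Rightarrow> bool" where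
  "order_inv es V k L \<longleftrightarrow> distinct L \<and> set L = V \<and> k \<le> length es \<and>
     (\<forall>(x, y) \<in> set es. x \<in> V \<and> y \<in> V \<and> x \<noteq> y) \<and>
     (\<forall>i < k. rk L (fst (es ! i)) < rk L (snd (es ! i)))"

text \<open>The pairs of arc indices in \<open>T\<close> are those traversed together in Case 5.\<close>

definition pairing :: "('v \<times> 'v) list \<Rightarrow> nat \<Rightarrow> 'v list \<Rightarrow> 'v search \<Rightarrow> (nat \<times> nat) set \<Rightarrow> bool" where
  "pairing es k L q T \<longleftrightarrow> finite T \<and> inj_on fst T \<and> inj_on snd T \<and> trav q = fst ` T \<union> snd ` T \<and>
     (\<forall>(i, j) \<in> T. i \<le> k \<and> j \<le> k \<and> fst (es ! i) \<in> fwd q \<and> snd (es ! j) \<in> bwd q \<and>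
        rk L (fst (es ! i)) < rk L (snd (es ! j)))"

text \<open>As \<open>lo\<close> only moves up and \<open>hi\<close> only down, a candidate deleted
  in Case 2 stays covered by the last alternative of \<open>fwd_cases\<close> or
  \<open>bwd_cases\<close>. \<open>B_soft\<close> and \<open>D_soft\<close> turn into
  \<open>A_lo\<close> and \<open>C_hi\<close> when Cases 1f and 1b make \<open>soft\<close> the new
  bound.\<close>

locale search_inv =
  fixes es :: "('v \<times> 'v) list" and V :: "'v set" and k :: nat and L :: "'v list" and q :: "'v search"
  assumes order: "order_inv es V k L" and k: "k < length es"
    and lo_V: "lo q \<in> V" and hi_V: "hi q \<in> V" and soft_V: "soft q \<in> V"
    and lo_soft: "rk L (lo q) \<le> rk L (soft q)" and soft_hi: "rk L (soft q) \<le> rk L (hi q)"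
    and fwd_V: "fwd q \<subseteq> V" and bwd_V: "bwd q \<subseteq> V" and disj: "fwd q \<inter> bwd q = {}"
    and head: "snd (es ! k) \<in> fwd q" and tail: "fst (es ! k) \<in> bwd q"
    and ABX: "setA q \<subseteq> fwd q" "setB q \<subseteq> fwd q" "setX q \<subseteq> fwd q"
    and CDY: "setC q \<subseteq> bwd q" "setD q \<subseteq> bwd q" "setY q \<subseteq> bwd q"
    and A_lo: "\<And>u. u \<in> setA q \<Longrightarrow> rk L (lo q) \<le> rk L u"
    and B_soft: "\<And>u. u \<in> setB q \<Longrightarrow> rk L (soft q) \<le> rk L u"
    and C_hi: "\<And>z. z \<in> setC q \<Longrightarrow> rk L z \<le> rk L (hi q)"
    and D_soft: "\<And>z. z \<in> setD q \<Longrightarrow> rk L z \<le> rk L (soft q)"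
    and fwd_cases: "\<And>u. u \<in> fwd q \<Longrightarrow> u \<in> setA q \<or> u \<in> setB q \<or> u \<in> setX q \<or> rk L (hi q) \<le> rk L u"
    and bwd_cases: "\<And>z. z \<in> bwd q \<Longrightarrow> z \<in> setC q \<or> z \<in> setD q \<or> z \<in> setY q \<or> rk L z \<le> rk L (lo q)"
    and trav_le: "\<And>i. i \<in> trav q \<Longrightarrow> i \<le> k"
    and trav_ends: "\<And>i. i \<in> trav q \<Longrightarrow> (fst (es ! i) \<in> fwd q \<and> snd (es ! i) \<in> fwd q) \<or>
      (fst (es ! i) \<in> bwd q \<and> snd (es ! i) \<in> bwd q)"
    and X_out: "\<And>u i. u \<in> setX q \<Longrightarrow> i \<in> out_arcs es k u \<Longrightarrow> i \<in> trav q"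
    and Y_in: "\<And>z i. z \<in> setY q \<Longrightarrow> i \<in> in_arcs es k z \<Longrightarrow> i \<in> trav q"
    and fwd_reach: "\<And>u. u \<in> fwd q \<Longrightarrow> (snd (es ! k), u) \<in> (set (take (Suc k) es))\<^sup>*"
    and bwd_reach: "\<And>z. z \<in> bwd q \<Longrightarrow> (z, fst (es ! k)) \<in> (set (take (Suc k) es))\<^sup>*"
    and ex_pairing: "\<exists>T. pairing es k L q T"

fun conf_inv :: "('v \<times> 'v) list \<Rightarrow> 'v set \<Rightarrow> 'v conf \<Rightarrow> bool" where
  "conf_inv es V (Ready k L) \<longleftrightarrow> order_inv es V k L"
| "conf_inv es V (Search k L q) \<longleftrightarrow> search_inv es V k L q"
| "conf_inv es V (PickF k L q) \<longleftrightarrow>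
     search_inv es V k L q \<and> lo q = soft q \<and> setB q = {} \<and> setA q \<noteq> {}"
| "conf_inv es V (PickB k L q) \<longleftrightarrow>
     search_inv es V k L q \<and> hi q = soft q \<and> setD q = {} \<and> setC q \<noteq> {}"
| "conf_inv es V Cycle \<longleftrightarrow> True"

lemma order_inv_arc:
  "order_inv es V k L \<Longrightarrow> i < length es \<Longrightarrow>
     fst (es ! i) \<in> V \<and> snd (es ! i) \<in> V \<and> fst (es ! i) \<noteq> snd (es ! i)"
  unfolding order_inv_def by (metis (mono_tags, lifting) case_prod_beta nth_mem)

context search_inv
begin

lemma dL: "distinct L" and sL: "set L = V"
  using order by (auto simp: order_inv_def)

lemma sets_V: "setA q \<subseteq> V" "setB q \<subseteq> V" "setC q \<subseteq> V" "setD q \<subseteq> V" "setX q \<subseteq> V" "setY q \<subseteq> V"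
  using ABX CDY fwd_V bwd_V by auto

lemma in_L:
  "x \<in> setA q \<Longrightarrow> x \<in> set L" "x \<in> setB q \<Longrightarrow> x \<in> set L" "x \<in> setC q \<Longrightarrow> x \<in> set L"
  "x \<in> setD q \<Longrightarrow> x \<in> set L" "x \<in> setX q \<Longrightarrow> x \<in> set L" "x \<in> setY q \<Longrightarrow> x \<in> set L"
  "x \<in> fwd q \<Longrightarrow> x \<in> set L" "x \<in> bwd q \<Longrightarrow> x \<in> set L"
  "lo q \<in> set L" "hi q \<in> set L" "soft q \<in> set L"
  unfolding sL using sets_V fwd_V bwd_V lo_V hi_V soft_V by auto

lemma fin [simp]:
  "finite (setA q)" "finite (setB q)" "finite (setC q)" "finite (setD q)"
  "finite (setX q)" "finite (setY q)" "finite (fwd q)" "finite (bwd q)" "finite (trav q)"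
proof -
  have V: "finite V" using sL by auto
  show "finite (setA q)" "finite (setB q)" "finite (setC q)" "finite (setD q)"
    "finite (setX q)" "finite (setY q)" "finite (fwd q)" "finite (bwd q)"
    using sets_V fwd_V bwd_V by (auto intro: finite_subset[OF _ V])
  show "finite (trav q)" using ex_pairing by (auto simp: pairing_def)
qed

text \<open>If \<open>z\<close> preceded \<open>u\<close>, failure of Case 3f would put
  \<open>u\<close> before \<open>soft\<close>, so the minimum in Case 3b would be \<open>u\<close>,
  and its failure would put \<open>u\<close> before \<open>z\<close>. Equality is excluded because
  \<open>fwd\<close> and \<open>bwd\<close> are disjoint.\<close>

lemma case5_less:
  assumes "u \<in> setA q" "z \<in> setC q"
    "\<not> cond2f L q u" "\<not> cond2b L q z" "\<not> cond3f L q u z" "\<not> cond3b L q u z"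
  shows "rk L u < rk L z"
proof -
  have m: "u \<in> set L" "z \<in> set L"
    using in_L assms(1,2) by auto
  have "u \<noteq> z" using assms(1,2) ABX CDY disj by auto
  then have "rk L u \<noteq> rk L z" using m dL by (simp add: rk_eq)
  then show ?thesis using assms(3-6) m dL in_L(9-11)
    by (simp add: cond2f_def cond2b_def cond3f_def cond3b_def rk_simps split: if_splits)
       (auto simp: min_def max_def split: if_splits)
qed

lemma traverse_inv:
  assumes uz: "u \<in> setA q" "z \<in> setC q" "rk L u < rk L z"
    and i: "i \<in> out_arcs es k u - trav q" and j: "j \<in> in_arcs es k z - trav q"
    and x: "x = snd (es ! i)" and y: "y = fst (es ! j)" and nc: "\<not> closes_cycle q x y"
  shows "search_inv es V k L (traverse q i x j y)"
proof -
  have ij: "i \<le> k" "i < length es" "fst (es ! i) = u" "j \<le> k" "j < length es" "snd (es ! j) = z"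
    "i \<notin> trav q" "j \<notin> trav q"
    using i j by (auto simp: out_arcs_def in_arcs_def)
  have nc': "x \<notin> bwd q" "x \<noteq> y" "y \<notin> fwd q" using nc by (auto simp: closes_cycle_def)
  have uf: "u \<in> fwd q" "u \<notin> bwd q" "z \<in> bwd q" "z \<notin> fwd q" using uz ABX CDY disj by auto
  \<comment> \<open>The new arc leaves a backward vertex, so an arc out of the forward
    \<open>u\<close> is an old one and respects \<open>L\<close>; this puts \<open>x\<close> beyond
    \<open>lo\<close>.\<close>
  have "i \<noteq> k" using uf ij tail by auto
  then have ux: "rk L u < rk L x" using ij order x by (auto simp: order_inv_def)
  have "j \<noteq> k" using uf ij head by auto
  then have yz: "rk L y < rk L z" using ij order y by (auto simp: order_inv_def)
  have xyV: "x \<in> V" "y \<in> V" using order_inv_arc[OF order] ij x y by auto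
  have ar: "(u, x) \<in> set (take (Suc k) es)" "(y, z) \<in> set (take (Suc k) es)"
    using ij x y by (force simp: in_set_conv_nth)+
  have reach: "(snd (es ! k), x) \<in> (set (take (Suc k) es))\<^sup>*"
    using fwd_reach[OF uf(1)] ar(1) by (rule rtrancl_into_rtrancl)
  have reach': "(y, fst (es ! k)) \<in> (set (take (Suc k) es))\<^sup>*"
    using ar(2) bwd_reach[OF uf(3)] by (rule converse_rtrancl_into_rtrancl)
  obtain T where T: "pairing es k L q T" using ex_pairing by auto
  have tr: "trav q = fst ` T \<union> snd ` T" and inj: "inj_on fst T" "inj_on snd T"
    using T by (auto simp: pairing_def)
  have "i \<notin> fst ` T" "j \<notin> snd ` T" using ij(7,8) unfolding tr by auto
  then have "inj_on fst (insert (i, j) T)" "inj_on snd (insert (i, j) T)"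
    using inj by auto
  then have T': "pairing es k L (traverse q i x j y) (insert (i, j) T)"
    using T ij uf uz(3) by (simp add: pairing_def traverse_def split_def) blast
  have lohi: "rk L (lo q) \<le> rk L x" "rk L y \<le> rk L (hi q)"
    using ux yz A_lo[OF uz(1)] C_hi[OF uz(2)] by auto
  show ?thesis
  proof
    show "\<exists>T. pairing es k L (traverse q i x j y) T" using T' by blast
  next
    fix a assume "a \<in> fwd (traverse q i x j y)"
    then show "a \<in> setA (traverse q i x j y) \<or> a \<in> setB (traverse q i x j y) \<or>
        a \<in> setX (traverse q i x j y) \<or> rk L (hi (traverse q i x j y)) \<le> rk L a"
      using fwd_cases[of a] nc' by (auto simp: traverse_def unreached_def)
  next
    fix a assume "a \<in> bwd (traverse q i x j y)"
    then show "a \<in> setC (traverse q i x j y) \<or> a \<in> setD (traverse q i x j y) \<or>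
        a \<in> setY (traverse q i x j y) \<or> rk L a \<le> rk L (lo (traverse q i x j y))"
      using bwd_cases[of a] nc' by (auto simp: traverse_def unreached_def)
  next
    fix a assume "a \<in> trav (traverse q i x j y)"
    then show "fst (es ! a) \<in> fwd (traverse q i x j y) \<and> snd (es ! a) \<in> fwd (traverse q i x j y) \<or>
        fst (es ! a) \<in> bwd (traverse q i x j y) \<and> snd (es ! a) \<in> bwd (traverse q i x j y)"
      using trav_ends[of a] ij uf x y by (auto simp: traverse_def)
  qed (use order k lo_V hi_V soft_V lo_soft soft_hi fwd_V bwd_V disj head tail ABX CDY A_lo B_soft
      C_hi D_soft trav_le X_out Y_in fwd_reach bwd_reach xyV nc' reach reach' lohi ij(1,4)
      in \<open>auto simp: traverse_def split: if_splits\<close>)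
qed

text \<open>If \<open>A\<close> and \<open>B\<close> are exhausted, \<open>s\<close> is
  \<open>hi\<close>: by \<open>fwd_cases\<close> a forward vertex before \<open>hi\<close> is in
  \<open>X\<close>, and since vertices of \<open>C\<close> and \<open>D\<close> never exceed
  \<open>hi\<close>, a backward vertex after \<open>hi\<close> is in \<open>Y\<close>. The other
  ending is symmetric.\<close>

lemma at_end:
  assumes nr: "\<not> running q"
  defines "s \<equiv> end_pos q"
  shows "s \<in> V"
    and "{x \<in> setX q. \<not> preceq L s x} = {x \<in> fwd q. rk L x < rk L s}"
    and "{y \<in> setY q. \<not> preceq L y s} = {y \<in> bwd q. rk L s < rk L y}"
proof -
  show s: "s \<in> V" using lo_V hi_V by (auto simp: s_def end_pos_def)
  have e: "(setA q = {} \<and> setB q = {} \<and> s = hi q) \<or> (setC q = {} \<and> setD q = {} \<and> s = lo q)"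
    using nr by (auto simp: running_def s_def end_pos_def)
  have "x \<in> setX q" if "x \<in> fwd q" "rk L x < rk L s" for x
    using that e fwd_cases[of x] A_lo[of x] B_soft[of x] lo_soft soft_hi by force
  then show "{x \<in> setX q. \<not> preceq L s x} = {x \<in> fwd q. rk L x < rk L s}"
    using ABX s sL dL in_L by (auto simp: preceq_rk)
  have "x \<in> setY q" if "x \<in> bwd q" "rk L s < rk L x" for x
    using that e bwd_cases[of x] C_hi[of x] D_soft[of x] lo_soft soft_hi by force
  then show "{y \<in> setY q. \<not> preceq L y s} = {y \<in> bwd q. rk L s < rk L y}"
    using CDY s sL dL in_L by (auto simp: preceq_rk)
qed

end

lemma search_inv_init:
  assumes o: "order_inv es V k L" and k: "k < length es" "es ! k = (v, w)" and n: "\<not> prec L v w"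
    and s: "preceq L w s" "preceq L s v"
  shows "search_inv es V k L (init_search v w s)"
proof -
  have d: "distinct L" "set L = V" using o by (auto simp: order_inv_def)
  have vw: "v \<in> V" "w \<in> V" "v \<noteq> w" using order_inv_arc[OF o k(1)] k(2) by auto
  have sV: "s \<in> V" using s(1) vw d prec_set[of L w s] by (auto simp: preceq_def)
  have "pairing es k L (init_search v w s) {}" by (simp add: pairing_def init_search_def)
  moreover have "rk L w \<le> rk L s" "rk L s \<le> rk L v" using s vw sV d by (auto simp: preceq_rk)
  ultimately show ?thesis using o k vw sV
    by unfold_locales (auto simp: init_search_def)
qed

section \<open>Preservation of the invariant by the cases that traverse no arc\<close>

context search_inv
begin

lemma pairing_update:
  "trav q' = trav q \<Longrightarrow> fwd q' = fwd q \<Longrightarrow> bwd q' = bwd q \<Longrightarrow> \<exists>T. pairing es k L q' T"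
  using ex_pairing by (simp add: pairing_def)

lemmas facts = order k lo_V hi_V soft_V lo_soft soft_hi fwd_V bwd_V disj head tail ABX CDY A_lo
  B_soft C_hi D_soft trav_le trav_ends X_out Y_in fwd_reach bwd_reach

lemma case1f_inv:
  assumes "setA q = {}"
  shows "search_inv es V k L (q\<lparr>setA := setB q, setB := {}, lo := soft q\<rparr>)"
proof -
  have "z \<in> setC q \<or> z \<in> setD q \<or> z \<in> setY q \<or> rk L z \<le> rk L (soft q)" if "z \<in> bwd q" for z
    using bwd_cases[OF that] lo_soft by auto
  then show ?thesis
    by unfold_locales (use facts fwd_cases assms in \<open>auto simp: pairing_update\<close>)
qed

lemma case1b_inv:
  assumes "setC q = {}"
  shows "search_inv es V k L (q\<lparr>setC := setD q, setD := {}, hi := soft q\<rparr>)"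
proof -
  have "u \<in> setA q \<or> u \<in> setB q \<or> u \<in> setX q \<or> rk L (soft q) \<le> rk L u" if "u \<in> fwd q" for u
    using fwd_cases[OF that] soft_hi by auto
  then show ?thesis
    by unfold_locales (use facts bwd_cases assms in \<open>auto simp: pairing_update\<close>)
qed

lemma pickf_inv:
  assumes t: "t \<in> setA q" and e: "lo q = soft q" "setB q = {}"
  shows "search_inv es V k L (q\<lparr>soft := omin L t (hi q)\<rparr>)"
proof -
  have r: "rk L (omin L t (hi q)) = min (rk L t) (rk L (hi q))"
    using t in_L dL by (simp add: rk_omin)
  have o: "omin L t (hi q) \<in> V" using t sets_V hi_V by (auto simp: omin_def)
  \<comment> \<open>Vertices of \<open>D\<close> are at most the old threshold, which is now
    \<open>lo\<close>, and every possible new threshold is at least \<open>lo\<close>.\<close>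
  have "rk L z \<le> rk L t" "rk L z \<le> rk L (hi q)" if "z \<in> setD q" for z
    using D_soft[OF that] A_lo[OF t] e soft_hi by auto
  then show ?thesis
    by unfold_locales
      (use facts fwd_cases bwd_cases A_lo[OF t] e r o in \<open>auto simp: pairing_update\<close>)
qed

lemma pickb_inv:
  assumes t: "t \<in> setC q" and e: "hi q = soft q" "setD q = {}"
  shows "search_inv es V k L (q\<lparr>soft := omax L t (lo q)\<rparr>)"
proof -
  have r: "rk L (omax L t (lo q)) = max (rk L t) (rk L (lo q))"
    using t in_L dL by (simp add: rk_omax)
  have o: "omax L t (lo q) \<in> V" using t sets_V lo_V by (auto simp: omax_def)
  have "rk L t \<le> rk L z" "rk L (lo q) \<le> rk L z" if "z \<in> setB q" for z
    using B_soft[OF that] C_hi[OF t] e lo_soft by auto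
  then show ?thesis
    by unfold_locales
      (use facts fwd_cases bwd_cases C_hi[OF t] e r o in \<open>auto simp: pairing_update\<close>)
qed

lemma fwd_A: "u \<in> fwd q \<Longrightarrow> u \<notin> setB q \<Longrightarrow> u \<notin> setX q \<Longrightarrow> \<not> rk L (hi q) \<le> rk L u \<Longrightarrow> u \<in> setA q"
  using fwd_cases by blast

lemma bwd_C: "z \<in> bwd q \<Longrightarrow> z \<notin> setD q \<Longrightarrow> z \<notin> setY q \<Longrightarrow> \<not> rk L z \<le> rk L (lo q) \<Longrightarrow> z \<in> setC q"
  using bwd_cases by blast

lemma case2f_inv:
  assumes "u \<in> setA q" "rk L (hi q) \<le> rk L u"
  shows "search_inv es V k L (q\<lparr>setA := setA q - {u}\<rparr>)"
  by unfold_locales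
    (use facts fwd_A bwd_C assms in \<open>auto simp: pairing_update\<close>)

lemma case2b_inv:
  assumes "z \<in> setC q" "rk L z \<le> rk L (lo q)"
  shows "search_inv es V k L (q\<lparr>setC := setC q - {z}\<rparr>)"
  by unfold_locales
    (use facts fwd_A bwd_C assms in \<open>auto simp: pairing_update\<close>)

lemma case3f_inv:
  assumes "u \<in> setA q" "rk L (soft q) \<le> rk L u"
  shows "search_inv es V k L (q\<lparr>setA := setA q - {u}, setB := insert u (setB q)\<rparr>)"
  by unfold_locales
    (use facts fwd_A bwd_C assms in \<open>auto simp: pairing_update\<close>)

lemma case3b_inv:
  assumes "z \<in> setC q" "rk L z \<le> rk L (soft q)"
  shows "search_inv es V k L (q\<lparr>setC := setC q - {z}, setD := insert z (setD q)\<rparr>)"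
  by unfold_locales
    (use facts fwd_A bwd_C assms in \<open>auto simp: pairing_update\<close>)

lemma case4f_inv:
  assumes "u \<in> setA q" "out_arcs es k u \<subseteq> trav q"
  shows "search_inv es V k L (q\<lparr>setA := setA q - {u}, setX := insert u (setX q)\<rparr>)"
  by unfold_locales
    (use facts fwd_A bwd_C assms in \<open>auto simp: pairing_update\<close>)

lemma case4b_inv:
  assumes "z \<in> setC q" "in_arcs es k z \<subseteq> trav q"
  shows "search_inv es V k L (q\<lparr>setC := setC q - {z}, setY := insert z (setY q)\<rparr>)"
  by unfold_locales
    (use facts fwd_A bwd_C assms in \<open>auto simp: pairing_update\<close>)

end

section \<open>Restoring the order, and absence of deadlock\<close>

context search_inv
begin

text \<open>Only arc \<open>k\<close> may violate the order, and it leads from backward to forward.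
  A completed vertex has all its relevant arcs traversed; the ends of a traversed arc are on the
  same side, and disjointness decides which.\<close>

lemma arc_cases:
  assumes i: "i \<le> k" and a: "a = fst (es ! i)" and b: "b = snd (es ! i)"
  shows "rk L a < rk L b \<or> a \<in> bwd q \<and> b \<in> fwd q"
    and "a \<in> V" "b \<in> V"
    and "a \<in> setX q \<Longrightarrow> b \<in> fwd q" "b \<in> setY q \<Longrightarrow> a \<in> bwd q"
proof -
  have il: "i < length es" using i k by simp
  show "rk L a < rk L b \<or> a \<in> bwd q \<and> b \<in> fwd q"
    using i order head tail unfolding a b by (cases "i = k") (auto simp: order_inv_def)
  show "a \<in> V" "b \<in> V" using order_inv_arc[OF order il] a b by auto
  show "b \<in> fwd q" if "a \<in> setX q"
  proof -
    have "i \<in> trav q" using X_out[OF that, of i] i il a by (auto simp: out_arcs_def)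
    then show ?thesis using trav_ends[of i] that ABX disj a b by auto
  qed
  show "a \<in> bwd q" if "b \<in> setY q"
  proof -
    have "i \<in> trav q" using Y_in[OF that, of i] i il b by (auto simp: in_arcs_def)
    then show ?thesis using trav_ends[of i] that CDY disj a b by auto
  qed
qed

lemma in_take_arcs: "(a, b) \<in> set (take (Suc k) es) \<longleftrightarrow> (\<exists>i\<le>k. a = fst (es ! i) \<and> b = snd (es ! i))"
  using k by (auto simp: in_set_conv_nth less_Suc_eq_le)

text \<open>
  When the search ends, the sets \<open>X\<close> and \<open>Y\<close> to be moved are all forward vertices before \<open>s\<close> and
  all backward vertices after \<open>s\<close>, and arcs out of \<open>X\<close> (into \<open>Y\<close>) have forward (backward) far ends.
\<close>

lemma reordered_inv:
  assumes nr: "\<not> running q" and re: "reordered es k L q L'"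
  shows "order_inv es V (Suc k) L'"
proof -
  define s where "s = end_pos q"
  define X where "X = {x \<in> fwd q. rk L x < rk L s}"
  define Y where "Y = {y \<in> bwd q. rk L s < rk L y}"
  note e = at_end[OF nr, folded s_def, folded X_def Y_def]
  note sV = e(1)
  obtain OX OY P Q where OX: "topological_order_on (take (Suc k) es) X OX"
    and OY: "topological_order_on (take (Suc k) es) Y OY"
    and F: "filter (\<lambda>x. x \<notin> X \<union> Y) L = P @ s # Q"
    and L': "L' = (if s \<notin> fwd q then P @ s # OY @ OX @ Q else P @ OY @ OX @ s # Q)"
    using re unfolding reordered_def Let_def s_def[symmetric] e(2,3) by blast
  have dF: "distinct (P @ s # Q)" using dL by (metis F distinct_filter)
  have sF: "set (P @ s # Q) = V - X - Y" unfolding F[symmetric] using sL by auto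
  have OXs: "distinct OX" "set OX = X" and OYs: "distinct OY" "set OY = Y"
    using OX OY by (auto simp: topological_order_on_def)
  have XY: "X \<inter> Y = {}" "X \<subseteq> V" "Y \<subseteq> V" using disj fwd_V bwd_V by (auto simp: X_def Y_def)
  have sXY: "s \<notin> X" "s \<notin> Y" by (auto simp: X_def Y_def)
  have dL': "distinct L'" using dF OXs OYs XY sF by (auto simp: L')
  have sL': "set L' = V" using OXs OYs XY sF by (auto simp: L')
  have rF: "prec (P @ s # Q) x y" if "x \<in> V - X - Y" "y \<in> V - X - Y" "rk L x < rk L y" for x y
    unfolding F[symmetric] prec_filter using that dL sL by (auto simp: prec_rk)
  have mP: "x \<in> set P" if "x \<in> V - X - Y" "rk L x < rk L s" for x
    using rF[of x s] that sV sXY dF prec_set[of Q x s] prec_set[of P x s]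
    by (auto simp: prec_append prec_Cons)
  have mQ: "x \<in> set Q" if "x \<in> V - X - Y" "rk L s < rk L x" for x
    using rF[of s x] that sV sXY dF prec_set[of Q s x] prec_set[of P s x]
    by (auto simp: prec_append prec_Cons)
  have ms: "rk L x = rk L s \<longleftrightarrow> x = s" if "x \<in> V" for x
    using that sV dL sL by (simp add: rk_eq)
  have XX: "X \<subseteq> setX q" "Y \<subseteq> setY q" using e(2,3) by auto
  have "prec L' a b" if i: "i \<le> k" and a: "a = fst (es ! i)" and b: "b = snd (es ! i)" for i a b
  proof -
    note c = arc_cases[OF i a b]
    have arc: "(a, b) \<in> set (take (Suc k) es)" unfolding in_take_arcs using i a b by blast
    have pX: "prec OX a b" if "a \<in> X" "b \<in> X" using that arc OX by (auto simp: topological_order_on_def)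
    have pY: "prec OY a b" if "a \<in> Y" "b \<in> Y" using that arc OY by (auto simp: topological_order_on_def)
    have cX: "b \<in> fwd q" if "a \<in> X" using that c(4) XX by auto
    have cY: "a \<in> bwd q" if "b \<in> Y" using that c(5) XX by auto
    have lin: "x \<in> X \<or> x \<in> Y \<or> x = s \<or> (x \<in> set P \<and> x \<notin> X \<and> x \<notin> Y \<and> rk L x < rk L s) \<or>
       (x \<in> set Q \<and> x \<notin> X \<and> x \<notin> Y \<and> rk L s < rk L x)" if "x \<in> V" for x
      using mP[of x] mQ[of x] ms[OF that] that by (cases "rk L x" "rk L s" rule: linorder_cases) auto
    have old: "prec (P @ s # Q) a b" if "a \<notin> X" "a \<notin> Y" "b \<notin> X" "b \<notin> Y" "rk L a < rk L b"
      using rF c(2,3) that by auto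
    \<comment> \<open>A backward vertex outside \<open>Y\<close> is not after \<open>s\<close>, a
      forward one outside \<open>X\<close> is not before \<open>s\<close>, and they cannot both be
      \<open>s\<close>.\<close>
    have new: "a \<in> set P \<and> b \<in> set Q \<or> a \<in> set P \<and> b = s \<or> a = s \<and> b \<in> set Q"
      if "a \<notin> X" "a \<notin> Y" "b \<notin> X" "b \<notin> Y" "a \<in> bwd q" "b \<in> fwd q"
      using lin[OF c(2)] lin[OF c(3)] that disj by (auto simp: X_def Y_def)
    \<comment> \<open>The side of \<open>s\<close> on which the blocks are inserted matters only for
      arcs between them and \<open>s\<close>: an arc from a block to \<open>s\<close> exists only
      for forward \<open>s\<close>, an arc from \<open>s\<close> into a block only for backward
      \<open>s\<close>.\<close>
    consider "a \<in> X" | "b \<in> Y" | "a \<in> Y" "b \<notin> Y" | "b \<in> X" "a \<notin> X" "a \<notin> Y"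
      | "a \<notin> X" "a \<notin> Y" "b \<notin> X" "b \<notin> Y" by blast
    then show ?thesis
    proof cases
      case 1
      then have "b \<in> X \<or> (b = s \<and> s \<in> fwd q) \<or> b \<in> set Q"
        using cX lin[OF c(3)] disj by (auto simp: X_def Y_def)
      then show ?thesis using 1 pX OXs by (auto simp: L' prec_append prec_Cons)
    next
      case 2
      then have "a \<in> Y \<or> (a = s \<and> s \<notin> fwd q) \<or> a \<in> set P"
        using cY lin[OF c(2)] disj by (auto simp: X_def Y_def)
      then show ?thesis using 2 pY OYs by (auto simp: L' prec_append prec_Cons)
    next
      case 3
      then have "b \<in> set Q \<or> b \<in> X \<or> (b = s \<and> s \<in> fwd q)"
        using c(1) lin[OF c(3)] disj by (auto simp: X_def Y_def)
      then show ?thesis using 3 OXs OYs by (auto simp: L' prec_append prec_Cons)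
    next
      case 4
      then have "a \<in> set P \<or> (a = s \<and> s \<notin> fwd q)"
        using c(1) lin[OF c(2)] disj by (auto simp: X_def Y_def)
      then show ?thesis using 4 OXs by (auto simp: L' prec_append prec_Cons)
    next
      case 5
      then have "prec (P @ s # Q) a b \<or> a \<in> set P \<and> b \<in> set Q \<or> a \<in> set P \<and> b = s \<or> a = s \<and> b \<in> set Q"
        using old new c(1) by blast
      then show ?thesis by (auto simp: L' prec_append prec_Cons)
    qed
  qed
  then have "\<forall>i < Suc k. rk L' (fst (es ! i)) < rk L' (snd (es ! i))"
    using dL' prec_rk prec_set by (metis less_Suc_eq_le)
  then show ?thesis using order k dL' sL' by (auto simp: order_inv_def)
qed

text \<open>Both blocks can inherit their order from \<open>L\<close>: the only arc that may
  disagree with \<open>L\<close> leads from a backward to a forward vertex, so it lies inside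
  neither \<open>X\<close> nor \<open>Y\<close>.\<close>

lemma reordered_ex:
  assumes nr: "\<not> running q"
  shows "\<exists>L'. reordered es k L q L'"
proof -
  define s where "s = end_pos q"
  define X where "X = {x \<in> setX q. \<not> preceq L s x}"
  define Y where "Y = {y \<in> setY q. \<not> preceq L y s}"
  have sV: "s \<in> V" using at_end[OF nr] by (simp add: s_def)
  have "s \<notin> X" "s \<notin> Y" by (auto simp: X_def Y_def preceq_def)
  then have "s \<in> set (filter (\<lambda>x. x \<notin> X \<union> Y) L)" using sV sL by auto
  then obtain P Q where F: "filter (\<lambda>x. x \<notin> X \<union> Y) L = P @ s # Q"
    by (meson split_list)
  have XV: "X \<subseteq> V" "Y \<subseteq> V" using sets_V by (auto simp: X_def Y_def)
  have p: "prec L a b" if "i \<le> k" "a = fst (es ! i)" "b = snd (es ! i)" "a \<notin> bwd q \<or> b \<notin> fwd q" for i a b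
    using arc_cases[OF that(1-3)] that(4) dL sL by (auto simp: prec_rk)
  have "topological_order_on (take (Suc k) es) Z (filter (\<lambda>x. x \<in> Z) L)"
    if "Z \<subseteq> V" "Z \<subseteq> fwd q \<or> Z \<subseteq> bwd q" for Z
    unfolding topological_order_on_def
    using that dL sL disj p by (auto simp: in_take_arcs prec_filter) blast+
  moreover have "X \<subseteq> fwd q" "Y \<subseteq> bwd q" using ABX CDY by (auto simp: X_def Y_def)
  ultimately have "topological_order_on (take (Suc k) es) X (filter (\<lambda>x. x \<in> X) L)"
    "topological_order_on (take (Suc k) es) Y (filter (\<lambda>x. x \<in> Y) L)" using XV by auto
  with F show ?thesis unfolding reordered_def Let_def s_def[symmetric] X_def[symmetric] Y_def[symmetric]
    by blast
qed

end

lemma step_inv: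
  assumes "step R es c c'" "conf_inv es V c"
  shows "conf_inv es V c'"
  using assms
proof cases
  case (add_consistent k v w L)
  then show ?thesis using assms(2) prec_set[of L v w]
    by (auto simp: order_inv_def less_Suc_eq prec_rk)
next
  case (add_search k v w L s)
  then show ?thesis using assms(2) by (auto intro: search_inv_init)
next
  case (case1f q k L)
  then show ?thesis using assms(2) search_inv.case1f_inv[of es V k L q] by (auto simp: running_def)
next
  case (pickf t q L k)
  then show ?thesis using assms(2) search_inv.pickf_inv[of es V k L q t] by (auto simp: set_softF_def)
next
  case (case1b q k L)
  then show ?thesis using assms(2) search_inv.case1b_inv[of es V k L q] by (auto simp: running_def)
next
  case (pickb t q L k)
  then show ?thesis using assms(2) search_inv.pickb_inv[of es V k L q t] by (auto simp: set_softB_def)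
next
  case (case2f u q z L k)
  then interpret search_inv es V k L q using assms(2) by simp
  show ?thesis using case2f case2f_inv[of u] in_L dL by (simp add: cond2f_def preceq_rk)
next
  case (case2b u q z L k)
  then interpret search_inv es V k L q using assms(2) by simp
  show ?thesis using case2b case2b_inv[of z] in_L dL by (simp add: cond2b_def preceq_rk)
next
  case (case3f u q z L k)
  then interpret search_inv es V k L q using assms(2) by simp
  show ?thesis using case3f case3f_inv[of u] in_L dL by (simp add: cond3f_def rk_simps)
next
  case (case3b u q z L k)
  then interpret search_inv es V k L q using assms(2) by simp
  show ?thesis using case3b case3b_inv[of z] in_L dL by (simp add: cond3b_def rk_simps)
next
  case (case4f u q z L k)
  then interpret search_inv es V k L q using assms(2) by simp
  show ?thesis using case4f case4f_inv[of u] by (simp add: cond4f_def)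
next
  case (case4b u q z L k)
  then interpret search_inv es V k L q using assms(2) by simp
  show ?thesis using case4b case4b_inv[of z] by (simp add: cond4b_def)
next
  case (case5 u q z L k i j x y)
  then interpret search_inv es V k L q using assms(2) by simp
  show ?thesis
    using case5 traverse_inv[OF case5(3,4) case5_less[OF case5(3-8)] case5(11-14)] by simp
next
  case (restore q k L L')
  then show ?thesis using assms(2) search_inv.reordered_inv by auto
qed

text \<open>Excludes that the time bounds are met by getting stuck, and makes the choice of a
  \<open>policy\<close> a genuine transition in every unfinished configuration that satisfies the
  invariant.\<close>

lemma progress:
  assumes "conf_inv es V c"
  shows "finished es c \<or> (\<exists>c'. step any_threshold es c c')"
proof (cases c)
  case (Ready k L)
  show ?thesis
  proof (cases "k < length es")
    case True
    obtain v w where vw: "es ! k = (v, w)" by fastforce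
    have o: "order_inv es V k L" using assms Ready by simp
    have "v \<in> V" "w \<in> V" using order_inv_arc[OF o True] vw by auto
    then have "prec L v w \<or> preceq L w v"
      using o by (auto simp: order_inv_def prec_rk preceq_rk)
    moreover have "preceq L v v" by (simp add: preceq_def)
    ultimately show ?thesis
      using step.add_consistent[OF True vw] step.add_search[OF True vw, of L v] Ready by blast
  qed (use Ready in auto)
next
  case (Search k L q)
  then interpret search_inv es V k L q using assms by simp
  consider "\<not> running q" | "running q" "setA q = {}" | "running q" "setC q = {}"
    | u z where "u \<in> setA q" "z \<in> setC q" by blast
  then show ?thesis
  proof cases
    case 1
    then show ?thesis using reordered_ex[OF 1] step.restore[OF 1] Search by blast
  next
    case 2
    then show ?thesis using step.case1f Search by blast
  next
    case 3
    then show ?thesis using step.case1b Search by blast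
  next
    case (4 u z)
    consider "cond2f L q u \<or> cond2b L q z"
      | "\<not> cond2f L q u" "\<not> cond2b L q z" "cond3f L q u z \<or> cond3b L q u z"
      | "\<not> cond2f L q u" "\<not> cond2b L q z" "\<not> cond3f L q u z" "\<not> cond3b L q u z"
        "cond4f es k q u \<or> cond4b es k q z"
      | "\<not> cond2f L q u" "\<not> cond2b L q z" "\<not> cond3f L q u z" "\<not> cond3b L q u z"
        "\<not> cond4f es k q u" "\<not> cond4b es k q z" by blast
    then show ?thesis
    proof cases
      case 1
      then show ?thesis using step.case2f[OF 4] step.case2b[OF 4] Search by blast
    next
      case 2
      then show ?thesis using step.case3f[OF 4] step.case3b[OF 4] Search by blast
    next
      case 3
      then show ?thesis using step.case4f[OF 4] step.case4b[OF 4] Search by blast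
    next
      case c: 4
      then obtain i j where "i \<in> out_arcs es k u - trav q" "j \<in> in_arcs es k z - trav q"
        by (auto simp: cond4f_def cond4b_def)
      then show ?thesis using step.case5[OF 4 c _ _ refl refl] Search by blast
    qed
  qed
next
  case (PickF k L q)
  then obtain t where "t \<in> setA q" using assms by auto
  then show ?thesis using step.pickf[of t q any_threshold L es k] PickF by auto
next
  case (PickB k L q)
  then obtain t where "t \<in> setC q" using assms by auto
  then show ?thesis using step.pickb[of t q any_threshold L es k] PickB by auto
qed auto

section \<open>Amortization within one search\<close>

definition active :: "'v list \<Rightarrow> 'v search \<Rightarrow> 'v \<Rightarrow> bool" where
  "active L q x \<longleftrightarrow> rk L (lo q) < rk L x \<and> rk L x < rk L (hi q)"

definition reached_active :: "'v list \<Rightarrow> 'v search \<Rightarrow> 'v set" where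
  "reached_active L q = {x \<in> fwd q \<union> bwd q. active L q x}"

text \<open>
  The next Case 1f or 1b discards one side of the soft threshold, so at most this many reached
  vertices remain active.
\<close>

definition spread :: "'v list \<Rightarrow> 'v search \<Rightarrow> nat" where
  "spread L q = max (card {x \<in> reached_active L q. rk L x < rk L (soft q)})
                    (card {x \<in> reached_active L q. rk L (soft q) < rk L x})"

text \<open>
  A vertex of \<open>B\<close> or \<open>D\<close> gets weight \<open>c + 1\<close> in the potential \<open>phi\<close> below: an inactive vertex that
  returns to \<open>A\<close> or \<open>C\<close> cannot be moved to \<open>B\<close> or \<open>D\<close> again, so it releases weight \<open>c - 1\<close>.
\<close>

definition weight :: "real \<Rightarrow> 'v list \<Rightarrow> 'v search \<Rightarrow> 'v \<Rightarrow> real" where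
  "weight c L q x = (if active L q x then c + 2 else 2)"

definition phi_rest :: "real \<Rightarrow> 'v search \<Rightarrow> real" where
  "phi_rest c q = (c + 1) * (card (setB q) + card (setD q)) + card (setX q) + card (setY q)
     + 2 * card (trav q) + 1"

definition phi :: "real \<Rightarrow> 'v list \<Rightarrow> 'v search \<Rightarrow> real" where
  "phi c L q = c * spread L q + sum (weight c L q) (setA q) + sum (weight c L q) (setC q)
     + phi_rest c q"

text \<open>The vertices just taken from \<open>B\<close> still carry the weight
  \<open>c + 1\<close>, and all reached active vertices count because no threshold divides them yet.
  The \<open>- 1\<close> is the payment for Case 1f; the choice makes it good, since its set is
  nonempty.\<close>

definition phiF :: "real \<Rightarrow> 'v list \<Rightarrow> 'v search \<Rightarrow> real" where
  "phiF c L q = c * card (reached_active L q) + (c + 1) * card (setA q) - 1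
     + sum (weight c L q) (setC q) + phi_rest c q"

definition phiB :: "real \<Rightarrow> 'v list \<Rightarrow> 'v search \<Rightarrow> real" where
  "phiB c L q = c * card (reached_active L q) + (c + 1) * card (setC q) - 1
     + sum (weight c L q) (setA q) + phi_rest c q"

text \<open>For \<open>t\<close> in \<open>S\<close>, being an \<open>eps\<close>-approximate median
  means exactly that this is at least \<open>eps * card S\<close>.\<close>

definition mid_rank :: "'v list \<Rightarrow> 'v set \<Rightarrow> 'v \<Rightarrow> nat" where
  "mid_rank L S t = min (card {x \<in> S. preceq L x t}) (card {x \<in> S. preceq L t x})"

lemma weight_bounds: "c \<ge> 0 \<Longrightarrow> 2 \<le> weight c L q x" "c \<ge> 0 \<Longrightarrow> weight c L q x \<le> c + 2"
  by (auto simp: weight_def)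

lemma sum_weight_nonneg: "c \<ge> 0 \<Longrightarrow> 0 \<le> sum (weight c L q) S"
  by (rule sum_nonneg) (auto simp: weight_def)

lemma phi_rest_ge: "c \<ge> 0 \<Longrightarrow> card (setX q) + card (setY q) + 2 * card (trav q) + 1 \<le> phi_rest c q"
  by (simp add: phi_rest_def)

lemma phi_ge: "c \<ge> 0 \<Longrightarrow> phi_rest c q \<le> phi c L q"
  using sum_weight_nonneg[of c L q] by (simp add: phi_def)

lemma weight_cong:
  "lo q' = lo q \<Longrightarrow> hi q' = hi q \<Longrightarrow> weight c L q' = weight c L q"
  by (simp add: weight_def active_def fun_eq_iff)

lemma reached_active_cong:
  "lo q' = lo q \<Longrightarrow> hi q' = hi q \<Longrightarrow> fwd q' = fwd q \<Longrightarrow> bwd q' = bwd q \<Longrightarrow>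
   reached_active L q' = reached_active L q"
  by (simp add: reached_active_def active_def)

lemma spread_cong:
  "lo q' = lo q \<Longrightarrow> hi q' = hi q \<Longrightarrow> fwd q' = fwd q \<Longrightarrow> bwd q' = bwd q \<Longrightarrow> soft q' = soft q \<Longrightarrow>
   spread L q' = spread L q"
  by (simp add: spread_def reached_active_cong[of q' q L])

lemma weight_antimono:
  assumes "c \<ge> 0" "rk L (lo q) \<le> rk L (lo q')" "rk L (hi q') \<le> rk L (hi q)"
  shows "sum (weight c L q') S \<le> sum (weight c L q) S"
  using assms by (intro sum_mono) (auto simp: weight_def active_def)

lemma mid_rank_split:
  assumes S: "finite S" "S \<subseteq> set L" "distinct L" "t \<in> S"
  shows "mid_rank L S t \<le> card {x \<in> S. \<not> P x} + card {x \<in> S. P x \<and> rk L x \<le> rk L t}"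
    and "mid_rank L S t \<le> card {x \<in> S. \<not> P x} + card {x \<in> S. P x \<and> rk L t \<le> rk L x}"
proof -
  have L: "x \<in> set L" if "x \<in> S" for x using S that by auto
  have "card {x \<in> S. preceq L x t} \<le> card ({x \<in> S. \<not> P x} \<union> {x \<in> S. P x \<and> rk L x \<le> rk L t})"
    using S L by (intro card_mono) (auto simp: preceq_rk)
  also have "\<dots> \<le> card {x \<in> S. \<not> P x} + card {x \<in> S. P x \<and> rk L x \<le> rk L t}" by (rule card_Un_le)
  finally show "mid_rank L S t \<le> card {x \<in> S. \<not> P x} + card {x \<in> S. P x \<and> rk L x \<le> rk L t}"
    by (simp add: mid_rank_def)
  have "card {x \<in> S. preceq L t x} \<le> card ({x \<in> S. \<not> P x} \<union> {x \<in> S. P x \<and> rk L t \<le> rk L x})"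
    using S L by (intro card_mono) (auto simp: preceq_rk)
  also have "\<dots> \<le> card {x \<in> S. \<not> P x} + card {x \<in> S. P x \<and> rk L t \<le> rk L x}" by (rule card_Un_le)
  finally show "mid_rank L S t \<le> card {x \<in> S. \<not> P x} + card {x \<in> S. P x \<and> rk L t \<le> rk L x}"
    by (simp add: mid_rank_def)
qed

lemma card_disjoint_le:
  "finite R \<Longrightarrow> A \<subseteq> R \<Longrightarrow> B \<subseteq> R \<Longrightarrow> A \<inter> B = {} \<Longrightarrow> card A + card B \<le> card R"
  by (metis card_Un_disjoint card_mono finite_subset le_sup_iff)

context search_inv
begin

lemma finite_reached_active [simp]: "finite (reached_active L q)"
  by (simp add: reached_active_def)

lemma sum_weight_diff:
  assumes "u \<in> S" "finite S"
  shows "sum (weight c L q) (S - {u}) = sum (weight c L q) S - weight c L q u"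
  using assms by (simp add: sum_diff1)

text \<open>
  Every vertex of \<open>S\<close> on the smaller side of \<open>t\<close> is either no longer counted in the spread or
  inactive and hence of smaller weight.  The two alternatives for \<open>s'\<close> are those of Cases 1f and 1b.
\<close>

lemma pick_bound:
  fixes c :: real
  assumes c: "c \<ge> 0" and S: "S \<subseteq> fwd q \<union> bwd q" "t \<in> S"
    and s': "s' \<in> V" "rk L s' = min (rk L t) (rk L (hi q)) \<or> rk L s' = max (rk L t) (rk L (lo q))"
  shows "1 + card S + sum (weight c L q) S + c * spread L (q\<lparr>soft := s'\<rparr>)
     \<le> c * card (reached_active L q) + (c + 1) * card S - 1 + 4 * card S - c * mid_rank L S t"
proof -
  have fS: "finite S" using S(1) by (rule finite_subset) simp
  have SL: "S \<subseteq> set L" using S(1) fwd_V bwd_V sL by auto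
  define a where "a = card {x \<in> S. active L q x}"
  define b where "b = card {x \<in> S. \<not> active L q x}"
  define R where "R = reached_active L q"
  have g: "card S = a + b"
    unfolding a_def b_def by (subst card_Un_disjoint[symmetric]) (auto intro: arg_cong[where f=card] simp: fS)
  have g1: "card S \<ge> 1" using S(2) fS by (simp add: card_gt_0_iff Suc_le_eq) blast
  have w: "sum (weight c L q) S = (c + 2) * a + 2 * b"
    using fS by (simp add: weight_def sum.If_cases a_def b_def Int_def Diff_eq conj_commute
        algebra_simps)
  have tL: "t \<in> set L" using S(2) SL by auto
  note m = mid_rank_split[OF fS SL dL S(2), of "active L q", folded b_def]
  have R: "finite R" "{x \<in> S. active L q x} \<subseteq> R"
    using S(1) by (auto simp: R_def reached_active_def)
  have act: "rk L (lo q) < rk L x \<and> rk L x < rk L (hi q)" if "x \<in> R" for x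
    using that by (auto simp: R_def reached_active_def active_def)
  have R': "reached_active L (q\<lparr>soft := s'\<rparr>) = R" by (simp add: R_def reached_active_def active_def)
  \<comment> \<open>The threshold \<open>s'\<close> differs from \<open>t\<close> only by clamping
    to \<open>lo\<close> or \<open>hi\<close>, beyond which no vertex of \<open>R\<close> lies. So
    the active vertices of \<open>S\<close> from \<open>t\<close> on are not counted before
    \<open>s'\<close>; \<open>d2\<close> is the mirror image.\<close>
  have d1: "card {x \<in> R. rk L x < rk L s'} + mid_rank L S t \<le> card R + b"
  proof (cases "\<exists>x \<in> R. rk L t \<le> rk L x \<and> rk L x < rk L s'")
    case False
    have "card {x \<in> R. rk L x < rk L s'} + card {x \<in> S. active L q x \<and> rk L t \<le> rk L x} \<le> card R"
      using R False by (intro card_disjoint_le) auto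
    then show ?thesis using m(2) by linarith
  next
    case True
    then obtain x where x: "x \<in> R" "rk L t \<le> rk L x" "rk L x < rk L s'" by blast
    then have tl: "rk L t \<le> rk L (lo q)" using s'(2) act[OF x(1)] by auto
    have e: "{x \<in> S. active L q x \<and> rk L x \<le> rk L t} = {}" using tl by (auto simp: active_def)
    have "card {x \<in> R. rk L x < rk L s'} \<le> card R" using R by (intro card_mono) auto
    then show ?thesis using m(1) unfolding e by simp
  qed
  have d2: "card {x \<in> R. rk L s' < rk L x} + mid_rank L S t \<le> card R + b"
  proof (cases "\<exists>x \<in> R. rk L x \<le> rk L t \<and> rk L s' < rk L x")
    case False
    have "card {x \<in> R. rk L s' < rk L x} + card {x \<in> S. active L q x \<and> rk L x \<le> rk L t} \<le> card R"
      using R False by (intro card_disjoint_le) auto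
    then show ?thesis using m(1) by linarith
  next
    case True
    then obtain x where x: "x \<in> R" "rk L x \<le> rk L t" "rk L s' < rk L x" by blast
    then have tl: "rk L (hi q) \<le> rk L t" using s'(2) act[OF x(1)] by auto
    have e: "{x \<in> S. active L q x \<and> rk L t \<le> rk L x} = {}" using tl by (auto simp: active_def)
    have "card {x \<in> R. rk L s' < rk L x} \<le> card R" using R by (intro card_mono) auto
    then show ?thesis using m(2) unfolding e by simp
  qed
  have "spread L (q\<lparr>soft := s'\<rparr>) + mid_rank L S t \<le> card R + b"
    using d1 d2 by (simp add: spread_def R')
  then have "c * (spread L (q\<lparr>soft := s'\<rparr>) + mid_rank L S t) \<le> c * (card R + b)"
    using c by (intro mult_left_mono) (simp_all flip: of_nat_add)
  \<comment> \<open>After cancellation \<open>2 * card S + 2 <= 4 * card S\<close> remains: the cost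
    \<open>card S + 1\<close>, one unit per vertex for the rise of its weight from
    \<open>c + 1\<close> to \<open>c + 2\<close>, and the unit advanced for Case 1. The
    \<open>c\<close> missing from an inactive vertex's weight balances the term
    \<open>b\<close>.\<close>
  then show ?thesis
    using g1 unfolding w g R_def[symmetric] by (simp add: algebra_simps)
qed

section \<open>Change of the local potential in each case\<close>

lemma phi_pickF:
  fixes c :: real
  assumes c: "c \<ge> 0" and t: "t \<in> setA q" and e: "setB q = {}"
  shows "1 + card (setA q) + phi c L (q\<lparr>soft := omin L t (hi q)\<rparr>)
    \<le> phiF c L q + 4 * card (setA q) - c * mid_rank L (setA q) t"
proof -
  have "omin L t (hi q) \<in> V" using omin_in[of t V "hi q" L] t sets_V hi_V by auto
  moreover have "rk L (omin L t (hi q)) = min (rk L t) (rk L (hi q))"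
    using t in_L dL by (simp add: rk_omin)
  ultimately show ?thesis
    using pick_bound[OF c _ t, of "omin L t (hi q)"] ABX
    by (simp add: phi_def phiF_def phi_rest_def weight_cong[of "q\<lparr>soft := _\<rparr>" q] le_supI1)
qed

lemma phi_pickB:
  fixes c :: real
  assumes c: "c \<ge> 0" and t: "t \<in> setC q" and e: "setD q = {}"
  shows "1 + card (setC q) + phi c L (q\<lparr>soft := omax L t (lo q)\<rparr>)
    \<le> phiB c L q + 4 * card (setC q) - c * mid_rank L (setC q) t"
proof -
  have "omax L t (lo q) \<in> V" using omax_in[of t V "lo q" L] t sets_V lo_V by auto
  moreover have "rk L (omax L t (lo q)) = max (rk L t) (rk L (lo q))"
    using t in_L dL by (simp add: rk_omax)
  ultimately show ?thesis
    using pick_bound[OF c _ t, of "omax L t (lo q)"] CDY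
    by (simp add: phi_def phiB_def phi_rest_def weight_cong[of "q\<lparr>soft := _\<rparr>" q] le_supI2)
qed

text \<open>Raising \<open>lo\<close> to \<open>soft\<close> keeps only the reached active vertices
  after \<open>soft\<close>, a side bounded by \<open>spread\<close>, and can only lower the weights
  in \<open>C\<close>.\<close>

lemma phi_case1f:
  fixes c :: real
  assumes c: "c \<ge> 0" and e: "setA q = {}"
  shows "1 + phiF c L (q\<lparr>setA := setB q, setB := {}, lo := soft q\<rparr>) \<le> phi c L q"
proof -
  let ?q = "q\<lparr>setA := setB q, setB := {}, lo := soft q\<rparr>"
  have "card (reached_active L ?q) \<le> card {x \<in> reached_active L q. rk L (soft q) < rk L x}"
    using lo_soft by (intro card_mono) (auto simp: reached_active_def active_def)
  then have "card (reached_active L ?q) \<le> spread L q" by (simp add: spread_def)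
  then have "c * card (reached_active L ?q) \<le> c * spread L q" using c by (intro mult_left_mono) simp_all
  moreover have "sum (weight c L ?q) (setC q) \<le> sum (weight c L q) (setC q)"
    using c lo_soft by (intro weight_antimono) auto
  ultimately show ?thesis
    using e by (simp add: phiF_def phi_def phi_rest_def algebra_simps)
qed

lemma phi_case1b:
  fixes c :: real
  assumes c: "c \<ge> 0" and e: "setC q = {}"
  shows "1 + phiB c L (q\<lparr>setC := setD q, setD := {}, hi := soft q\<rparr>) \<le> phi c L q"
proof -
  let ?q = "q\<lparr>setC := setD q, setD := {}, hi := soft q\<rparr>"
  have "card (reached_active L ?q) \<le> card {x \<in> reached_active L q. rk L x < rk L (soft q)}"
    using soft_hi by (intro card_mono) (auto simp: reached_active_def active_def)
  then have "card (reached_active L ?q) \<le> spread L q" by (simp add: spread_def)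
  then have "c * card (reached_active L ?q) \<le> c * spread L q" using c by (intro mult_left_mono) simp_all
  moreover have "sum (weight c L ?q) (setA q) \<le> sum (weight c L q) (setA q)"
    using c soft_hi by (intro weight_antimono) auto
  ultimately show ?thesis
    using e by (simp add: phiB_def phi_def phi_rest_def algebra_simps)
qed

lemma card_insert_real: "finite S \<Longrightarrow> real (card (insert u S)) \<le> real (card S) + 1"
  by (simp add: card_insert_if)

lemma phi_case2f:
  fixes c :: real
  assumes "c \<ge> 0" "u \<in> setA q"
  shows "1 + phi c L (q\<lparr>setA := setA q - {u}\<rparr>) \<le> phi c L q"
  using assms weight_bounds(1)[of c L q u]
  by (simp add: phi_def phi_rest_def weight_cong[of "setA_update _ q" q]
      spread_cong[of "setA_update _ q" q] sum_weight_diff)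

lemma phi_case2b:
  fixes c :: real
  assumes "c \<ge> 0" "z \<in> setC q"
  shows "1 + phi c L (q\<lparr>setC := setC q - {z}\<rparr>) \<le> phi c L q"
  using assms weight_bounds(1)[of c L q z]
  by (simp add: phi_def phi_rest_def weight_cong[of "setC_update _ q" q]
      spread_cong[of "setC_update _ q" q] sum_weight_diff)

lemma phi_case3f:
  fixes c :: real
  assumes "c \<ge> 0" "u \<in> setA q" "active L q u"
  shows "1 + phi c L (q\<lparr>setA := setA q - {u}, setB := insert u (setB q)\<rparr>) \<le> phi c L q"
proof -
  let ?q = "q\<lparr>setA := setA q - {u}, setB := insert u (setB q)\<rparr>"
  have "weight c L q u = c + 2" using assms(3) by (simp add: weight_def)
  moreover have "(c + 1) * card (insert u (setB q)) \<le> (c + 1) * (card (setB q) + 1)"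
    using assms(1) card_insert_real[of "setB q" u] by (intro mult_left_mono) auto
  ultimately show ?thesis
    using assms(1,2) by (simp add: phi_def phi_rest_def weight_cong[of ?q q] spread_cong[of ?q q]
        sum_weight_diff algebra_simps)
qed

lemma phi_case3b:
  fixes c :: real
  assumes "c \<ge> 0" "z \<in> setC q" "active L q z"
  shows "1 + phi c L (q\<lparr>setC := setC q - {z}, setD := insert z (setD q)\<rparr>) \<le> phi c L q"
proof -
  let ?q = "q\<lparr>setC := setC q - {z}, setD := insert z (setD q)\<rparr>"
  have "weight c L q z = c + 2" using assms(3) by (simp add: weight_def)
  moreover have "(c + 1) * card (insert z (setD q)) \<le> (c + 1) * (card (setD q) + 1)"
    using assms(1) card_insert_real[of "setD q" z] by (intro mult_left_mono) auto
  ultimately show ?thesis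
    using assms(1,2) by (simp add: phi_def phi_rest_def weight_cong[of ?q q] spread_cong[of ?q q]
        sum_weight_diff algebra_simps)
qed

lemma phi_case4f:
  fixes c :: real
  assumes "c \<ge> 0" "u \<in> setA q"
  shows "1 + phi c L (q\<lparr>setA := setA q - {u}, setX := insert u (setX q)\<rparr>) \<le> phi c L q"
proof -
  let ?q = "q\<lparr>setA := setA q - {u}, setX := insert u (setX q)\<rparr>"
  show ?thesis
    using assms weight_bounds(1)[of c L q u] card_insert_real[of "setX q" u]
    by (simp add: phi_def phi_rest_def weight_cong[of ?q q] spread_cong[of ?q q] sum_weight_diff)
qed

lemma phi_case4b:
  fixes c :: real
  assumes "c \<ge> 0" "z \<in> setC q"
  shows "1 + phi c L (q\<lparr>setC := setC q - {z}, setY := insert z (setY q)\<rparr>) \<le> phi c L q"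
proof -
  let ?q = "q\<lparr>setC := setC q - {z}, setY := insert z (setY q)\<rparr>"
  show ?thesis
    using assms weight_bounds(1)[of c L q z] card_insert_real[of "setY q" z]
    by (simp add: phi_def phi_rest_def weight_cong[of ?q q] spread_cong[of ?q q] sum_weight_diff)
qed

text \<open>At most two vertices become reached: \<open>2 * c\<close> for \<open>spread\<close>,
  \<open>2 * (c + 2)\<close> for their weights and 1 for the step make \<open>4 * c + 5\<close>,
  covered because \<open>trav\<close> grows by at least one. The other 2 is the coefficient of
  \<open>card (trav q)\<close> in \<open>phi_rest\<close>.\<close>

lemma phi_traverse:
  fixes c :: real and x y i j
  assumes c: "c \<ge> 0" and "i \<notin> trav q"
  defines "q' \<equiv> traverse q i x j y"
  shows "1 + phi c L q' \<le> phi c L q + (4 * c + 7) * (card (trav q') - real (card (trav q)))"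
proof -
  have w: "weight c L q' = weight c L q" by (rule weight_cong) (simp_all add: q'_def traverse_def)
  have ins: "sum (weight c L q) (if b then insert x S else S) \<le> sum (weight c L q) S + (c + 2)"
    if "finite S" for b x S
    using c weight_bounds[OF c, of L q x] that by (simp add: sum.insert_if)
  have card2: "card {z \<in> reached_active L q'. P z} \<le> card {z \<in> reached_active L q. P z} + 2" for P
  proof -
    have "{z \<in> reached_active L q'. P z} \<subseteq> insert x (insert y {z \<in> reached_active L q. P z})"
      by (auto simp: reached_active_def q'_def traverse_def active_def)
    then have "card {z \<in> reached_active L q'. P z} \<le> card (insert x (insert y {z \<in> reached_active L q. P z}))"
      by (intro card_mono) auto
    also have "\<dots> \<le> card {z \<in> reached_active L q. P z} + 2" by (simp add: card_insert_if)
    finally show ?thesis .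
  qed
  have so: "soft q' = soft q" by (simp add: q'_def traverse_def)
  have "spread L q' \<le> spread L q + 2"
    using card2[of "\<lambda>z. rk L z < rk L (soft q)"] card2[of "\<lambda>z. rk L (soft q) < rk L z"]
    unfolding spread_def so by linarith
  then have "real (spread L q') \<le> real (spread L q) + 2" by linarith
  then have "c * spread L q' \<le> c * (spread L q + 2)" using c by (intro mult_left_mono) simp_all
  moreover have "sum (weight c L q) (setA q') \<le> sum (weight c L q) (setA q) + (c + 2)"
    using ins[of "setA q" "unreached q x" x] by (simp add: q'_def traverse_def)
  moreover have "sum (weight c L q) (setC q') \<le> sum (weight c L q) (setC q) + (c + 2)"
    using ins[of "setC q" "unreached q y" y] by (simp add: q'_def traverse_def)
  moreover have "phi_rest c q' = phi_rest c q + 2 * (card (trav q') - real (card (trav q)))"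
    by (simp add: phi_rest_def q'_def traverse_def)
  moreover have "card (trav q') \<ge> card (insert i (trav q))"
    unfolding q'_def traverse_def by (intro card_mono) auto
  then have "1 \<le> card (trav q') - real (card (trav q))" using assms(2) by simp
  then have "(4 * c + 5) * 1 \<le> (4 * c + 5) * (card (trav q') - real (card (trav q)))"
    using c by (intro mult_left_mono) auto
  ultimately show ?thesis unfolding phi_def w by (simp add: algebra_simps)
qed

lemma phi_restore:
  fixes c :: real
  assumes c: "c \<ge> 0" and nr: "\<not> running q"
  shows "cost es (Search k L q) \<le> phi c L q"
proof -
  have "(\<Union>x \<in> setX q. out_arcs es k x) \<subseteq> trav q" "(\<Union>y \<in> setY q. in_arcs es k y) \<subseteq> trav q"
    using X_out Y_in by auto
  then have "card (\<Union>x \<in> setX q. out_arcs es k x) \<le> card (trav q)"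
    "card (\<Union>y \<in> setY q. in_arcs es k y) \<le> card (trav q)" by (auto intro: card_mono)
  then have "cost es (Search k L q) \<le> card (setX q) + card (setY q) + 2 * card (trav q) + 1"
    using nr by simp
  then show ?thesis using phi_rest_ge[OF c, of q] phi_ge[OF c, of q L] by linarith
qed

end

text \<open>The constant collects 1 for adding the arc, \<open>2 * c\<close> for
  \<open>spread\<close>, \<open>2 * (c + 2)\<close> for the weights of \<open>v\<close> and
  \<open>w\<close>, and 1 kept for restoring the order.\<close>

lemma phi_init:
  fixes c :: real
  assumes "c \<ge> 0"
  shows "1 + phi c L (init_search v w s) \<le> 4 * c + 6"
proof -
  have "card {x \<in> reached_active L (init_search v w s). P x} \<le> card {v, w}" for P
    by (intro card_mono) (auto simp: reached_active_def init_search_def)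
  also have "card {v, w} \<le> 2" by (simp add: card_insert_if)
  finally have "spread L (init_search v w s) \<le> 2" by (simp add: spread_def)
  then have "c * spread L (init_search v w s) \<le> c * 2" using assms by (intro mult_left_mono) auto
  moreover have "sum (weight c L (init_search v w s)) (setA (init_search v w s)) \<le> c + 2"
     "sum (weight c L (init_search v w s)) (setC (init_search v w s)) \<le> c + 2"
    using assms by (auto simp: init_search_def weight_def)
  ultimately show ?thesis by (simp add: phi_def phi_rest_def init_search_def)
qed

section \<open>Related arcs\<close>

text \<open>Only the connecting path must consist of the first \<open>k\<close> arcs; the two arcs
  of the pair may be added later. So the relation grows with \<open>k\<close> inside a fixed set of
  pairs.\<close>

definition related :: "('v \<times> 'v) list \<Rightarrow> nat \<Rightarrow> (nat \<times> nat) set" where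
  "related es k = {(j, i). j < length es \<and> i < length es \<and>
     (snd (es ! j), fst (es ! i)) \<in> (set (take k es))\<^sup>*}"

lemma related_sub: "related es k \<subseteq> {..<length es} \<times> {..<length es}"
  by (auto simp: related_def)

lemma finite_related [simp]: "finite (related es k)"
  by (rule finite_subset[OF related_sub]) simp

lemma card_related: "card (related es k) \<le> length es * length es"
  using card_mono[OF _ related_sub[of es k]] by simp

lemma related_mono: "related es k \<subseteq> related es (Suc k)"
proof -
  have "set (take k es) \<subseteq> set (take (Suc k) es)" by (simp add: set_take_subset_set_take)
  then show ?thesis unfolding related_def using rtrancl_mono by blast
qed

lemma order_inv_rtrancl:
  assumes o: "order_inv es V k L" and r: "(a, b) \<in> (set (take k es))\<^sup>*"
  shows "rk L a \<le> rk L b"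
  using r
proof induction
  case (step y z)
  then obtain i where "i < k" "y = fst (es ! i)" "z = snd (es ! i)"
    by (auto simp: in_set_conv_nth)
  then show ?case using o step.IH by (auto simp: order_inv_def intro: order.trans less_imp_le)
qed simp

text \<open>
  Sorting the arcs traversed forward by their tails shows that at least half of all pairs of steps
  combine to an arc pair with tail before head, which cannot have been related before the addition.
\<close>

lemma (in search_inv) trav_related:
  "card (trav q) * card (trav q) + 8 * card (related es k) \<le> 8 * card (related es (Suc k))"
proof -
  obtain T where T: "pairing es k L q T" using ex_pairing by auto
  then have fT: "finite T" and inj: "inj_on fst T" "inj_on snd T"
    and tr: "trav q = fst ` T \<union> snd ` T" by (auto simp: pairing_def)
  have TT: "fst p \<le> k \<and> snd p \<le> k \<and> fst (es ! fst p) \<in> fwd q \<and> snd (es ! snd p) \<in> bwd q \<and>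
      rk L (fst (es ! fst p)) < rk L (snd (es ! snd p))" if "p \<in> T" for p
    using T that by (auto simp: pairing_def)
  define n where "n = card T"
  have "card (trav q) \<le> card (fst ` T) + card (snd ` T)" unfolding tr by (rule card_Un_le)
  also have "\<dots> \<le> n + n" unfolding n_def using card_image_le[OF fT] by (intro add_mono) auto
  finally have n: "card (trav q) * card (trav q) \<le> (n + n) * (n + n)" by (intro mult_le_mono)
  define G where "G = {(p, p') \<in> T \<times> T. rk L (fst (es ! fst p)) < rk L (snd (es ! snd p'))}"
  have fG: "finite G" unfolding G_def by (rule finite_subset[of _ "T \<times> T"]) (auto simp: fT)
  \<comment> \<open>Write \<open>u\<close>, \<open>z\<close> for the ends of \<open>p\<close> and
    \<open>u'\<close>, \<open>z'\<close> for those of \<open>p'\<close>. If both orientations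
    failed, then \<open>z' <= u < z <= u' < z'\<close> in rank.\<close>
  have "T \<times> T \<subseteq> G \<union> prod.swap ` G"
  proof clarify
    fix a b a' b' assume p: "(a, b) \<in> T" "(a', b') \<in> T" "((a, b), (a', b')) \<notin> prod.swap ` G"
    have "((a, b), (a', b')) \<in> G \<or> ((a', b'), (a, b)) \<in> G"
      using TT[OF p(1)] TT[OF p(2)] p(1,2) by (auto simp: G_def)
    then show "((a, b), (a', b')) \<in> G" using p(3) by force
  qed
  then have "card (T \<times> T) \<le> card (G \<union> prod.swap ` G)" using fG by (intro card_mono) auto
  also have "\<dots> \<le> card G + card (prod.swap ` G)" by (rule card_Un_le)
  also have "\<dots> \<le> card G + card G" using card_image_le[OF fG] by (intro add_mono) auto
  \<comment> \<open>With \<open>card (trav q) <= 2 * n\<close> this gives the factor 8: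
    \<open>(2 * n)^2 <= 8 * card G\<close>.\<close>
  finally have nG: "n * n \<le> 2 * card G" by (simp add: n_def card_cartesian_product)
  define f where "f = (\<lambda>(p :: nat \<times> nat, p' :: nat \<times> nat). (snd p', fst p))"
  have "inj_on f G"
    using inj unfolding inj_on_def f_def G_def by (auto; blast)
  then have cf: "card (f ` G) = card G" by (rule card_image)
  have kin: "(fst (es ! k), snd (es ! k)) \<in> set (take (Suc k) es)"
    using k by (simp add: take_Suc_conv_app_nth)
  \<comment> \<open>The backward arc comes first: its head reaches the tail of arc \<open>k\<close>,
    whose head reaches the tail of the forward arc. A path of old arcs would contradict the
    ranks.\<close>
  have "f ` G \<subseteq> related es (Suc k) - related es k"
  proof
    fix r assume "r \<in> f ` G"
    then obtain p p' where r: "r = (snd p', fst p)" and p: "p \<in> T" "p' \<in> T"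
      and lt: "rk L (fst (es ! fst p)) < rk L (snd (es ! snd p'))"
      by (auto simp: G_def f_def)
    have "(snd (es ! snd p'), fst (es ! k)) \<in> (set (take (Suc k) es))\<^sup>*"
      using TT[OF p(2)] bwd_reach by blast
    moreover have "(snd (es ! k), fst (es ! fst p)) \<in> (set (take (Suc k) es))\<^sup>*"
      using TT[OF p(1)] fwd_reach by blast
    ultimately have "(snd (es ! snd p'), fst (es ! fst p)) \<in> (set (take (Suc k) es))\<^sup>*"
      using kin by (meson rtrancl_into_rtrancl rtrancl_trans)
    moreover have "(snd (es ! snd p'), fst (es ! fst p)) \<notin> (set (take k es))\<^sup>*"
      using order_inv_rtrancl[OF order] lt by (meson leD)
    ultimately show "r \<in> related es (Suc k) - related es k"
      using TT[OF p(1)] TT[OF p(2)] k by (auto simp: r related_def)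
  qed
  then have "card G \<le> card (related es (Suc k) - related es k)"
    unfolding cf[symmetric] by (intro card_mono) auto
  also have "\<dots> = card (related es (Suc k)) - card (related es k)"
    by (simp add: card_Diff_subset related_mono)
  finally have "card G + card (related es k) \<le> card (related es (Suc k))"
    using card_mono[OF _ related_mono[of es k]] by simp
  then show ?thesis using n nG by (simp add: algebra_simps)
qed

section \<open>The global potential\<close>

text \<open>Each remaining arc holds the price of starting a search and the linear part of the bound
  on its traversals; each pair not yet related holds its share of the quadratic part.\<close>

definition base :: "real \<Rightarrow> ('v \<times> 'v) list \<Rightarrow> nat \<Rightarrow> real" where
  "base c es k = real (length es - k) * ((4 * c + 7) * sqrt (length es) + (4 * c + 6)) +
     2 * (4 * c + 7) * (real (length es * length es) - real (card (related es k))) / sqrt (length es)"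

text \<open>During a search \<open>base\<close> stays at \<open>k\<close>, because the new pairs
  count only at \<open>Suc k\<close>. By \<open>base_search\<close>, what is left after the
  deductions always covers \<open>base\<close> at \<open>Suc k\<close>, which is handed on by
  \<open>restore\<close>.\<close>

fun pot :: "real \<Rightarrow> ('v \<times> 'v) list \<Rightarrow> 'v conf \<Rightarrow> real" where
  "pot c es (Ready k L) = base c es k"
| "pot c es (Search k L q) =
     base c es k - (4 * c + 6) - (4 * c + 7) * card (trav q) + phi c L q"
| "pot c es (PickF k L q) =
     base c es k - (4 * c + 6) - (4 * c + 7) * card (trav q) + phiF c L q"
| "pot c es (PickB k L q) =
     base c es k - (4 * c + 6) - (4 * c + 7) * card (trav q) + phiB c L q"
| "pot c es Cycle = 0"

lemma base_nonneg: "c \<ge> 0 \<Longrightarrow> 0 \<le> base c es k"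
  using card_related[of es k] unfolding base_def
  by (intro add_nonneg_nonneg mult_nonneg_nonneg divide_nonneg_nonneg) (simp_all flip: of_nat_mult)

lemma base_Suc:
  assumes c: "c \<ge> 0" and k: "k < length es"
    and t: "t * t + 8 * card (related es k) \<le> 8 * card (related es (Suc k))"
  shows "base c es (Suc k) + (4 * c + 6) + (4 * c + 7) * real t \<le> base c es k"
proof -
  define s where "s = sqrt (length es)"
  have s: "s > 0" using k by (auto simp: s_def)
  define r where "r = real (card (related es k))"
  define r' where "r' = real (card (related es (Suc k)))"
  have "real (t * t + 8 * card (related es k)) \<le> real (8 * card (related es (Suc k)))"
    using t of_nat_le_iff by blast
  then have t': "real t * real t \<le> 8 * (r' - r)" by (simp add: r_def r'_def)
  \<comment> \<open>This is \<open>t <= s + t^2 / (4 * s)\<close>; with \<open>t^2\<close> at most 8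
    times the number of new pairs it yields the factor 2 in \<open>base\<close>.\<close>
  have "0 \<le> (real t - 2 * s) * (real t - 2 * s)" by simp
  then have "4 * s * real t \<le> 4 * s * s + 8 * (r' - r)" using t' by (simp add: algebra_simps)
  then have "real t \<le> s + 2 * (r' - r) / s" using s by (simp add: field_simps)
  then have "(4 * c + 7) * real t \<le> (4 * c + 7) * (s + 2 * (r' - r) / s)"
    using c by (intro mult_left_mono) auto
  then have "(4 * c + 7) * real t \<le> (4 * c + 7) * s + (4 * c + 7) * (2 * (r' - r) / s)"
    by (simp only: distrib_left)
  moreover have "2 * (4 * c + 7) * (M - r) / s = 2 * (4 * c + 7) * (M - r') / s + (4 * c + 7) * (2 * (r' - r) / s)"
    for M by (simp add: divide_inverse algebra_simps)
  moreover have "real (length es - k) * E = real (length es - Suc k) * E + E" for E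
    using k by (simp add: left_diff_distrib distrib_right)
  ultimately show ?thesis
    unfolding base_def s_def[symmetric] r_def[symmetric] r'_def[symmetric] by simp
qed

lemma (in search_inv) base_search:
  assumes "c \<ge> 0"
  shows "base c es (Suc k) + (4 * c + 6) + (4 * c + 7) * card (trav q) \<le> base c es k"
  using base_Suc[OF assms k trav_related] .

lemma pot_nonneg:
  assumes c: "c \<ge> 0" and I: "conf_inv es V C"
  shows "0 \<le> pot c es C"
proof (cases C)
  case (Search k L q)
  then interpret search_inv es V k L q using I by simp
  show ?thesis
    using base_search[OF c] base_nonneg[OF c, of es "Suc k"] phi_ge[OF c, of q L]
      phi_rest_ge[OF c, of q] Search by simp
next
  case (PickF k L q)
  then interpret search_inv es V k L q using I by simp
  have "0 \<le> phiF c L q"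
    using phi_rest_ge[OF c, of q] sum_weight_nonneg[OF c, of L q "setC q"] c
      mult_nonneg_nonneg[of c "card (reached_active L q)"]
      mult_nonneg_nonneg[of "c + 1" "card (setA q)"]
    unfolding phiF_def by linarith
  then show ?thesis
    using base_search[OF c] base_nonneg[OF c, of es "Suc k"] PickF by simp
next
  case (PickB k L q)
  then interpret search_inv es V k L q using I by simp
  have "0 \<le> phiB c L q"
    using phi_rest_ge[OF c, of q] sum_weight_nonneg[OF c, of L q "setA q"] c
      mult_nonneg_nonneg[of c "card (reached_active L q)"]
      mult_nonneg_nonneg[of "c + 1" "card (setC q)"]
    unfolding phiB_def by linarith
  then show ?thesis
    using base_search[OF c] base_nonneg[OF c, of es "Suc k"] PickB by simp
qed (use base_nonneg[OF c] in auto)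

lemma pot_pickF:
  fixes c :: real
  assumes "c \<ge> 0" "conf_inv es V (PickF k L q)" "t \<in> setA q"
  shows "cost es (PickF k L q) + pot c es (set_softF k L q t)
    \<le> pot c es (PickF k L q) + 4 * card (setA q) - c * mid_rank L (setA q) t"
  using search_inv.phi_pickF[of es V k L q c t] assms by (simp add: set_softF_def)

lemma pot_pickB:
  fixes c :: real
  assumes "c \<ge> 0" "conf_inv es V (PickB k L q)" "t \<in> setC q"
  shows "cost es (PickB k L q) + pot c es (set_softB k L q t)
    \<le> pot c es (PickB k L q) + 4 * card (setC q) - c * mid_rank L (setC q) t"
  using search_inv.phi_pickB[of es V k L q c t] assms by (simp add: set_softB_def)

lemma running_A: "u \<in> setA q \<Longrightarrow> z \<in> setC q \<Longrightarrow> running q"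
  by (auto simp: running_def)

lemma step_pot:
  assumes c: "c \<ge> 0" and st: "step R es C C'" and I: "conf_inv es V C"
    and np: "\<And>k L q. C \<noteq> PickF k L q" "\<And>k L q. C \<noteq> PickB k L q"
  shows "cost es C + pot c es C' \<le> pot c es C"
  using st
proof cases
  case (add_consistent k v w L)
  then show ?thesis using base_Suc[OF c add_consistent(3), of 0] c
      card_mono[OF _ related_mono[of es k]] by simp
next
  case (add_search k v w L s)
  then show ?thesis using phi_init[OF c, of L v w s] by (simp add: init_search_def)
next
  case (case1f q k L)
  then show ?thesis using I search_inv.phi_case1f[of es V k L q c] c by simp
next
  case (case1b q k L)
  then show ?thesis using I search_inv.phi_case1b[of es V k L q c] c by simp
next
  case (case2f u q z L k)
  then show ?thesis using I search_inv.phi_case2f[of es V k L q c u] c running_A[of u q z] by simp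
next
  case (case2b u q z L k)
  then show ?thesis using I search_inv.phi_case2b[of es V k L q c z] c running_A[of u q z] by simp
next
  case (case3f u q z L k)
  then interpret search_inv es V k L q using I by simp
  \<comment> \<open>The priority of Case 2 enters here: \<open>u\<close> is not before
    \<open>z\<close>, and \<open>z\<close> lies beyond \<open>lo\<close> because Case 2b does not
    apply.\<close>
  have "active L q u" using case3f in_L dL
    by (auto simp: active_def cond3f_def cond2f_def cond2b_def rk_simps)
  then show ?thesis using case3f phi_case3f[OF c case3f(3)] running_A[of u q z] by simp
next
  case (case3b u q z L k)
  then interpret search_inv es V k L q using I by simp
  have "active L q z" using case3b in_L dL
    by (auto simp: active_def cond3b_def cond2f_def cond2b_def rk_simps)
  then show ?thesis using case3b phi_case3b[OF c case3b(4)] running_A[of u q z] by simp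
next
  case (case4f u q z L k)
  then show ?thesis using I search_inv.phi_case4f[of es V k L q c u] c running_A[of u q z] by simp
next
  case (case4b u q z L k)
  then show ?thesis using I search_inv.phi_case4b[of es V k L q c z] c running_A[of u q z] by simp
next
  case (case5 u q z L k i j x y)
  then interpret search_inv es V k L q using I by simp
  have r: "cost es C = 1" using case5 running_A[of u q z] by simp
  show ?thesis
  proof (cases "closes_cycle q x y")
    case True
    \<comment> \<open>The unit reserved for restoring the order pays for the step that reports the
      cycle.\<close>
    have "1 \<le> phi c L q" using phi_ge[OF c, of q L] phi_rest_ge[OF c, of q] by simp
    then show ?thesis
      using True r case5(1,2) base_search[OF c] base_nonneg[OF c, of es "Suc k"] by simp
  next
    case False
    then show ?thesis using r case5(1,2,11) phi_traverse[OF c, of i x j y]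
      by (simp add: algebra_simps)
  qed
next
  case (restore q k L L')
  then interpret search_inv es V k L q using I by simp
  show ?thesis using restore(1,2) phi_restore[OF c restore(3)] base_search[OF c] by simp
qed (use np in auto)

text \<open>With \<open>m\<close> arcs and factor \<open>m * sqrt m\<close>, the traversal allowance
  gives \<open>4 * c + 7\<close>, the pairs give \<open>8 * c + 14\<close>, and the starting prices
  give at most \<open>4 * c + 6\<close> because \<open>sqrt m >= 1\<close>.\<close>

lemma pot_start:
  assumes c: "c \<ge> 0"
  shows "pot c es (Ready 0 L) \<le> length es * ((16 * c + 27) * sqrt (length es))"
proof (cases "es = []")
  case False
  define s where "s = sqrt (length es)"
  have m: "real (length es) = s * s" by (simp add: s_def)
  have "real (length es) \<ge> 1" using False by (simp add: Suc_le_eq)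
  then have s: "s \<ge> 1" by (simp add: s_def)
  have "base c es 0 \<le> real (length es) * ((4 * c + 7) * s + (4 * c + 6)) +
     2 * (4 * c + 7) * (real (length es) * real (length es)) / s"
    unfolding base_def s_def[symmetric] using c s
    by (intro add_mono divide_right_mono mult_left_mono) auto
  also have "\<dots> = s * s * ((4 * c + 7) * s + (4 * c + 6)) + 2 * (4 * c + 7) * (s * s) * s"
    using s unfolding m by simp
  also have "\<dots> = s * s * ((12 * c + 21) * s + (4 * c + 6) * 1)" by (simp add: algebra_simps)
  also have "\<dots> \<le> s * s * ((12 * c + 21) * s + (4 * c + 6) * s)"
    using c s by (intro mult_left_mono add_left_mono) auto
  also have "\<dots> = length es * ((16 * c + 27) * s)" unfolding m by (simp add: algebra_simps)
  finally show ?thesis by (simp add: s_def)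
qed (simp add: base_def related_def)

lemma arc_sequence_inv: "arc_sequence L es \<Longrightarrow> conf_inv es (set L) (Ready 0 L)"
  by (auto simp: arc_sequence_def order_inv_def)

lemma exec_inv: "exec R es C t C' \<Longrightarrow> conf_inv es V C \<Longrightarrow> conf_inv es V C'"
  by (induction rule: exec.induct) (auto intro: step_inv)

section \<open>Approximate medians\<close>

lemma step_pot_median:
  assumes e: "eps > 0" and st: "step (approx_median eps) es C C'" and I: "conf_inv es V C"
  shows "cost es C + pot (4 / eps) es C' \<le> pot (4 / eps) es C"
proof -
  have c: "4 / eps \<ge> 0" using e by simp
  have m: "4 * card S \<le> 4 / eps * mid_rank L S t" if "approx_median eps L S t" for L and S :: "'a set" and t
    using that e by (simp add: approx_median_def mid_rank_def field_simps min_def)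
  show ?thesis
  proof (cases C)
    case (PickF k L q)
    with st obtain t where t: "t \<in> setA q" "approx_median eps L (setA q) t" "C' = set_softF k L q t"
      by (auto elim: step.cases)
    then show ?thesis using pot_pickF[OF c I[unfolded PickF] t(1)] m[OF t(2)] PickF by simp
  next
    case (PickB k L q)
    with st obtain t where t: "t \<in> setC q" "approx_median eps L (setC q) t" "C' = set_softB k L q t"
      by (auto elim: step.cases)
    then show ?thesis using pot_pickB[OF c I[unfolded PickB] t(1)] m[OF t(2)] PickB by simp
  qed (use step_pot[OF c st I] in auto)
qed

lemma exec_pot:
  assumes "eps > 0" "exec (approx_median eps) es C t C'" "conf_inv es V C"
  shows "t + pot (4 / eps) es C' \<le> pot (4 / eps) es C"
  using assms(2)
proof induction
  case (exec_step t c' c'')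
  then show ?case using step_pot_median[OF assms(1) exec_step(2) exec_inv[OF exec_step(1) assms(3)]]
    by simp
qed simp

section \<open>Random soft thresholds\<close>

text \<open>The larger of \<open>i\<close> and \<open>g + 1 - i\<close> is at most
  \<open>g + 1\<close>, so the minimum is at least \<open>i * (g + 1 - i) / (g + 1)\<close>, and
  these products have a closed sum.\<close>

lemma sum_min_ge: "real g * real g \<le> 6 * (\<Sum>i = 1..g. real (min i (g + 1 - i)))"
proof -
  \<comment> \<open>\<open>N\<close> is kept apart from the upper limit so that induction on
    \<open>n\<close> goes through; it is used with \<open>N = g + 1\<close>.\<close>
  have q: "6 * (\<Sum>i = 1..n. real i * (N - real i)) = 3 * N * real n * (n + 1) - real n * (n + 1) * (2 * n + 1)"
    for n and N :: real
    by (induction n) (simp_all add: algebra_simps)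
  have "(\<Sum>i = 1..g. real i * (real (g + 1) - real i)) \<le> (\<Sum>i = 1..g. real (g + 1) * real (min i (g + 1 - i)))"
  proof (rule sum_mono)
    fix i assume "i \<in> {1..g}"
    then have "i * (g + 1 - i) \<le> (g + 1) * min i (g + 1 - i)"
      using mult_le_mono[of i "g + 1" "g + 1 - i" "g + 1 - i"] mult_le_mono[of i i "g + 1 - i" "g + 1"]
      by (auto simp: min_def mult.commute)
    then have "real (i * (g + 1 - i)) \<le> real ((g + 1) * min i (g + 1 - i))"
      by (rule of_nat_mono)
    with \<open>i \<in> {1..g}\<close> show "real i * (real (g + 1) - real i) \<le> real (g + 1) * real (min i (g + 1 - i))"
      by (simp add: distrib_right)
  qed
  then have "6 * (\<Sum>i = 1..g. real i * (real (g + 1) - real i)) \<le> real (g + 1) * (6 * (\<Sum>i = 1..g. real (min i (g + 1 - i))))"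
    unfolding sum_distrib_left[of "real (g + 1)", symmetric] by simp
  also have "6 * (\<Sum>i = 1..g. real i * (real (g + 1) - real i)) = real (g + 1) * (real g * (g + 2))"
    unfolding q by (simp add: algebra_simps)
  finally have "real g * (g + 2) \<le> 6 * (\<Sum>i = 1..g. real (min i (g + 1 - i)))"
    by (simp add: mult_le_cancel_left)
  then show ?thesis by (simp add: algebra_simps)
qed

text \<open>The position \<open>p\<close> within \<open>S\<close> is a bijection onto
  \<open>{1..card S}\<close>, and the two sides of \<open>t\<close> overlap in \<open>t\<close>
  alone, which turns \<open>mid_rank\<close> into
  \<open>min (p t) (card S + 1 - p t)\<close>.\<close>

lemma sum_mid_rank:
  assumes S: "finite S" "S \<subseteq> set L" "distinct L"
  shows "real (card S) * real (card S) \<le> 6 * (\<Sum>t \<in> S. real (mid_rank L S t))"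
proof -
  define p where "p t = card {x \<in> S. preceq L x t}" for t
  have L: "x \<in> set L" if "x \<in> S" for x using S that by auto
  have less: "p t < p t'" if "t \<in> S" "t' \<in> S" "rk L t < rk L t'" for t t'
  proof -
    have "{x \<in> S. preceq L x t} \<subseteq> {x \<in> S. preceq L x t'}"
      using that S L by (auto simp: preceq_rk)
    moreover have "t' \<in> {x \<in> S. preceq L x t'} - {x \<in> S. preceq L x t}"
      using that S L by (auto simp: preceq_rk)
    ultimately show ?thesis unfolding p_def using S(1) by (intro psubset_card_mono) auto
  qed
  have inj: "inj_on p S"
    using less S L by (intro inj_onI) (metis nat_neq_iff rk_eq)
  have "p ` S \<subseteq> {1..card S}"
  proof
    fix i assume "i \<in> p ` S"
    then obtain t where t: "t \<in> S" "i = p t" by auto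
    have "0 < p t" unfolding p_def using t S by (subst card_gt_0_iff) (auto simp: preceq_def)
    moreover have "p t \<le> card S" unfolding p_def using S by (intro card_mono) auto
    ultimately show "i \<in> {1..card S}" using t by auto
  qed
  then have im: "p ` S = {1..card S}" using inj S by (intro card_subset_eq) (auto simp: card_image)
  have q: "mid_rank L S t = min (p t) (card S + 1 - p t)" if "t \<in> S" for t
  proof -
    have "card {x \<in> S. preceq L x t} + card {x \<in> S. preceq L t x}
      = card ({x \<in> S. preceq L x t} \<union> {x \<in> S. preceq L t x})
        + card ({x \<in> S. preceq L x t} \<inter> {x \<in> S. preceq L t x})"
      using S by (intro card_Un_Int) auto
    also have "{x \<in> S. preceq L x t} \<union> {x \<in> S. preceq L t x} = S"
      using S L that by (auto simp: preceq_rk)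
    also have "{x \<in> S. preceq L x t} \<inter> {x \<in> S. preceq L t x} = {t}"
      using S L that by (auto simp: preceq_rk) (metis rk_eq)
    finally have "card {x \<in> S. preceq L t x} = card S + 1 - p t" by (simp add: p_def)
    then show ?thesis by (simp add: mid_rank_def p_def)
  qed
  have "(\<Sum>t \<in> S. real (mid_rank L S t)) = (\<Sum>t \<in> S. real (min (p t) (card S + 1 - p t)))"
    by (intro sum.cong) (simp_all add: q)
  also have "\<dots> = (\<Sum>i = 1..card S. real (min i (card S + 1 - i)))"
    using sum.reindex[OF inj, of "\<lambda>i. real (min i (card S + 1 - i))"] by (simp add: im o_def)
  finally show ?thesis using sum_min_ge[of "card S"] by simp
qed

text \<open>The constant 24 is 4 times the 6 of \<open>sum_mid_rank\<close>: the average of the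
  subtracted term is at least \<open>4 * card S\<close>.\<close>

lemma nn_integral_pick:
  fixes f :: "'v \<Rightarrow> real" and b :: real
  assumes S: "finite S" "S \<noteq> {}" "S \<subseteq> set L" "distinct L"
    and f: "\<And>t. t \<in> S \<Longrightarrow> 0 \<le> f t" "\<And>t. t \<in> S \<Longrightarrow> f t \<le> b + 4 * card S - 24 * mid_rank L S t"
  shows "(\<integral>\<^sup>+ t. ennreal (f t) \<partial>measure_pmf (pmf_of_set S)) \<le> ennreal b"
proof -
  have g: "real (card S) > 0" using S by (simp add: card_gt_0_iff)
  have "sum f S \<le> (\<Sum>t \<in> S. b + 4 * card S - 24 * real (mid_rank L S t))"
    by (intro sum_mono) (use f(2) in simp)
  also have "\<dots> = card S * b + 4 * (real (card S) * card S) - 24 * (\<Sum>t \<in> S. real (mid_rank L S t))"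
    by (simp add: sum_subtractf sum_distrib_left algebra_simps)
  also have "\<dots> \<le> card S * b" using sum_mid_rank[OF S(1,3,4)] by simp
  finally have "sum f S / card S \<le> b" using g by (simp add: field_simps)
  moreover have "(\<integral>\<^sup>+ t. ennreal (f t) \<partial>measure_pmf (pmf_of_set S)) = ennreal (sum f S / card S)"
    using S f(1) g
    by (simp add: nn_integral_pmf_of_set sum_nonneg divide_ennreal[symmetric] ennreal_of_nat_eq_real_of_nat)
  ultimately show ?thesis by (simp add: ennreal_leI)
qed

section \<open>Elapsed time plus potential as a supermartingale\<close>

definition charge :: "('v \<times> 'v) list \<Rightarrow> 'v conf list \<Rightarrow> ennreal" where
  "charge es h = ennreal (elapsed es h + pot 24 es (hd h))"

lemma random_step_inv:
  assumes po: "policy es \<sigma>" and I: "conf_inv es V C" and C': "C' \<in> set_pmf (random_step es \<sigma> (C # h))"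
  shows "conf_inv es V C'"
proof -
  have "step any_threshold es C C' \<or> C' = C"
  proof (cases "finished es C")
    case True
    then show ?thesis using C' by (cases C) (auto simp: random_step_def)
  next
    case False
    then have s: "step any_threshold es C (\<sigma> (C # h))"
      using progress[OF I] po by (auto simp: policy_def)
    have "finite (setA q)" "finite (setC q)" if "C = PickF k L q \<or> C = PickB k L q" for k L q
      using that I search_inv.fin by fastforce+
    then show ?thesis using C' s I False
      by (cases C) (auto simp: random_step_def intro: step.pickf step.pickb)
  qed
  then show ?thesis using step_inv I by blast
qed

text \<open>The history \<open>C # h\<close> is fixed, so the policy's move is one particular
  transition, covered by \<open>step_pot\<close> for every possible choice; only the two threshold
  choices need an average.\<close>

lemma random_step_charge:
  assumes po: "policy es \<sigma>" and I: "conf_inv es V C"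
  shows "(\<integral>\<^sup>+ C'. charge es (C' # C # h) \<partial>measure_pmf (random_step es \<sigma> (C # h))) \<le> charge es (C # h)"
proof -
  define e where "e = real (elapsed es (C # h))"
  have e: "e \<ge> 0" by (simp add: e_def)
  have ch: "charge es (C' # C # h) = ennreal (e + cost es C + pot 24 es C')" for C'
    by (simp add: charge_def e_def elapsed_def add_ac)
  have ch0: "charge es (C # h) = ennreal (e + pot 24 es C)" by (simp add: charge_def e_def)
  have nonneg: "0 \<le> e + cost es C + pot 24 es C'" if "C' \<in> set_pmf (random_step es \<sigma> (C # h))" for C'
    using e pot_nonneg[OF _ random_step_inv[OF po I that], of 24] by simp
  consider k L q where "C = PickF k L q" | k L q where "C = PickB k L q"
    | "\<And>k L q. C \<noteq> PickF k L q" "\<And>k L q. C \<noteq> PickB k L q" by blast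
  then show ?thesis
  proof cases
    case (1 k L q)
    then interpret search_inv es V k L q using I by simp
    have A: "setA q \<noteq> {}" "setA q \<subseteq> set L" using 1 I in_L by auto
    have rs: "random_step es \<sigma> (C # h) = map_pmf (set_softF k L q) (pmf_of_set (setA q))"
      by (simp add: random_step_def 1)
    have "(\<integral>\<^sup>+ t. ennreal (e + cost es C + pot 24 es (set_softF k L q t)) \<partial>measure_pmf (pmf_of_set (setA q)))
        \<le> ennreal (e + pot 24 es C)"
    proof (rule nn_integral_pick[OF fin(1) A dL])
      fix t assume t: "t \<in> setA q"
      show "0 \<le> e + cost es C + pot 24 es (set_softF k L q t)"
        using nonneg[of "set_softF k L q t"] t A by (simp add: rs)
      show "e + cost es C + pot 24 es (set_softF k L q t)
          \<le> e + pot 24 es C + 4 * card (setA q) - 24 * mid_rank L (setA q) t"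
        using pot_pickF[OF _ I[unfolded 1] t, of 24] unfolding 1 by simp
    qed
    then show ?thesis unfolding rs ch ch0 by simp
  next
    case (2 k L q)
    then interpret search_inv es V k L q using I by simp
    have A: "setC q \<noteq> {}" "setC q \<subseteq> set L" using 2 I in_L by auto
    have rs: "random_step es \<sigma> (C # h) = map_pmf (set_softB k L q) (pmf_of_set (setC q))"
      by (simp add: random_step_def 2)
    have "(\<integral>\<^sup>+ t. ennreal (e + cost es C + pot 24 es (set_softB k L q t)) \<partial>measure_pmf (pmf_of_set (setC q)))
        \<le> ennreal (e + pot 24 es C)"
    proof (rule nn_integral_pick[OF fin(3) A dL])
      fix t assume t: "t \<in> setC q"
      show "0 \<le> e + cost es C + pot 24 es (set_softB k L q t)"
        using nonneg[of "set_softB k L q t"] t A by (simp add: rs)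
      show "e + cost es C + pot 24 es (set_softB k L q t)
          \<le> e + pot 24 es C + 4 * card (setC q) - 24 * mid_rank L (setC q) t"
        using pot_pickB[OF _ I[unfolded 2] t, of 24] unfolding 2 by simp
    qed
    then show ?thesis unfolding rs ch ch0 by simp
  next
    case 3
    then have rs: "random_step es \<sigma> (C # h) = return_pmf (if finished es C then C else \<sigma> (C # h))"
      by (cases C) (auto simp: random_step_def)
    show ?thesis
    proof (cases "finished es C")
      case True
      then have "cost es C = 0" by (cases C) auto
      then show ?thesis unfolding rs ch ch0 using True by simp
    next
      case False
      then have "step any_threshold es C (\<sigma> (C # h))"
        using progress[OF I] po by (auto simp: policy_def)
      then have "cost es C + pot 24 es (\<sigma> (C # h)) \<le> pot 24 es C"
        using step_pot[OF _ _ I 3] by simp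
      then show ?thesis unfolding rs ch ch0 using False by (simp add: ennreal_leI)
    qed
  qed
qed

lemma history_inv:
  assumes "policy es \<sigma>" "conf_inv es V C" "h \<in> set_pmf (history es \<sigma> C n)"
  shows "\<exists>C' h'. h = C' # h' \<and> conf_inv es V C'"
  using assms(3)
proof (induction n arbitrary: h)
  case (Suc n)
  then obtain h0 C' where h0: "h0 \<in> set_pmf (history es \<sigma> C n)" "C' \<in> set_pmf (random_step es \<sigma> h0)"
    "h = C' # h0" by auto
  then show ?case using Suc.IH[OF h0(1)] random_step_inv[OF assms(1)] by blast
qed (use assms(2) in auto)

lemma history_charge:
  assumes po: "policy es \<sigma>" and I: "conf_inv es V C"
  shows "(\<integral>\<^sup>+ h. charge es h \<partial>measure_pmf (history es \<sigma> C n)) \<le> ennreal (pot 24 es C)"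
proof (induction n)
  case 0
  then show ?case by (simp add: charge_def elapsed_def)
next
  case (Suc n)
  have "(\<integral>\<^sup>+ h. charge es h \<partial>measure_pmf (history es \<sigma> C (Suc n))) =
      (\<integral>\<^sup>+ h. (\<integral>\<^sup>+ C'. charge es (C' # h) \<partial>measure_pmf (random_step es \<sigma> h)) \<partial>measure_pmf (history es \<sigma> C n))"
    by simp
  also have "\<dots> \<le> (\<integral>\<^sup>+ h. charge es h \<partial>measure_pmf (history es \<sigma> C n))"
  proof (rule nn_integral_mono_AE, unfold AE_measure_pmf_iff, rule ballI)
    fix h assume "h \<in> set_pmf (history es \<sigma> C n)"
    then obtain C' h' where "h = C' # h'" "conf_inv es V C'" using history_inv[OF po I] by blast
    then show "(\<integral>\<^sup>+ C'. charge es (C' # h) \<partial>measure_pmf (random_step es \<sigma> h)) \<le> charge es h"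
      using random_step_charge[OF po] by simp
  qed
  finally show ?case using Suc.IH by simp
qed

text \<open>Nonnegativity of the potential bounds elapsed time by \<open>charge\<close>, and the
  bound on its mean does not depend on \<open>n\<close>, so it passes to the supremum.\<close>

lemma expected_time_le:
  assumes po: "policy es \<sigma>" and I: "conf_inv es V C"
  shows "expected_time es \<sigma> C \<le> ennreal (pot 24 es C)"
  unfolding expected_time_def
proof (rule SUP_least)
  fix n
  have "(\<integral>\<^sup>+ h. of_nat (elapsed es h) \<partial>measure_pmf (history es \<sigma> C n))
      \<le> (\<integral>\<^sup>+ h. charge es h \<partial>measure_pmf (history es \<sigma> C n))"
  proof (rule nn_integral_mono_AE, unfold AE_measure_pmf_iff, rule ballI)
    fix h assume "h \<in> set_pmf (history es \<sigma> C n)"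
    then obtain C' h' where "h = C' # h'" "conf_inv es V C'" using history_inv[OF po I] by blast
    then have "0 \<le> pot 24 es (hd h)" using pot_nonneg[of 24 es V C'] by simp
    then show "of_nat (elapsed es h) \<le> charge es h"
      unfolding charge_def ennreal_of_nat_eq_real_of_nat by (intro ennreal_leI) simp
  qed
  also have "\<dots> \<le> ennreal (pot 24 es C)" using history_charge[OF po I] .
  finally show "(\<integral>\<^sup>+ h. of_nat (elapsed es h) \<partial>measure_pmf (history es \<sigma> C n)) \<le> ennreal (pot 24 es C)" .
qed

text \<open>Every transition costs at least one unit, so the deterministic time bound also limits
  the number of transitions; the first part shows that an execution can be continued until it is
  finished.\<close>

theorem theorem3:
  shows
    "(\<forall>(L :: 'v list) es t c.
        arc_sequence L es \<longrightarrow> exec any_threshold es (Ready 0 L) t c \<longrightarrow>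
        finished es c \<or> (\<exists>c'. step any_threshold es c c'))
   \<and> (\<forall>eps > 0. \<exists>K. \<forall>(L :: 'v list) es t c.
        arc_sequence L es \<longrightarrow> exec (approx_median eps) es (Ready 0 L) t c \<longrightarrow>
        real t \<le> real (length es) * (K * sqrt (real (length es))))
   \<and> (\<exists>K. \<forall>(L :: 'v list) es \<sigma>.
        arc_sequence L es \<longrightarrow> policy es \<sigma> \<longrightarrow>
        expected_time es \<sigma> (Ready 0 L)
          \<le> ennreal (real (length es) * (K * sqrt (real (length es)))))"
proof (intro conjI allI impI)
  fix L :: "'v list" and es t c
  assume "arc_sequence L es" "exec any_threshold es (Ready 0 L) t c"
  then show "finished es c \<or> (\<exists>c'. step any_threshold es c c')"
    using progress exec_inv arc_sequence_inv by metis
next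
  fix eps :: real assume eps: "eps > 0"
  show "\<exists>K. \<forall>(L :: 'v list) es t c. arc_sequence L es \<longrightarrow>
      exec (approx_median eps) es (Ready 0 L) t c \<longrightarrow>
      real t \<le> real (length es) * (K * sqrt (real (length es)))"
  proof (intro exI[of _ "16 * (4 / eps) + 27"] allI impI)
    fix L :: "'v list" and es t c
    assume "arc_sequence L es" and x: "exec (approx_median eps) es (Ready 0 L) t c"
    then have I: "conf_inv es (set L) (Ready 0 L)" by (simp only: arc_sequence_inv)
    have c: "4 / eps \<ge> 0" using eps by simp
    have "real t \<le> pot (4 / eps) es (Ready 0 L)"
      using exec_pot[OF eps x I] pot_nonneg[OF c exec_inv[OF x I]] by linarith
    also note pot_start[OF c, of es L]
    finally show "real t \<le> real (length es) * ((16 * (4 / eps) + 27) * sqrt (real (length es)))" .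
  qed
next
  show "\<exists>K. \<forall>(L :: 'v list) es \<sigma>. arc_sequence L es \<longrightarrow> policy es \<sigma> \<longrightarrow>
      expected_time es \<sigma> (Ready 0 L) \<le> ennreal (real (length es) * (K * sqrt (real (length es))))"
  proof (intro exI[of _ "16 * 24 + 27"] allI impI)
    fix L :: "'v list" and es \<sigma>
    assume "arc_sequence L es" and po: "policy es \<sigma>"
    then have "conf_inv es (set L) (Ready 0 L)" by (simp only: arc_sequence_inv)
    note expected_time_le[OF po this]
    also have "ennreal (pot 24 es (Ready 0 L))
        \<le> ennreal (real (length es) * ((16 * 24 + 27) * sqrt (real (length es))))"
      by (intro ennreal_leI pot_start) simp
    finally show "expected_time es \<sigma> (Ready 0 L)
        \<le> ennreal (real (length es) * ((16 * 24 + 27) * sqrt (real (length es))))" .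
  qed
qed

end
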